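(* Consider a finite sequence $\{\mathbf{X}_k\}$ of independent, random, Hermitian matrices with common dimension $d$. Assume that $$0 \leq \lambda_{\min}(\mathbf{X}_k) \quad\text{and}\quad \lambda_{\max}(\mathbf{X}_k) \leq L \quad\text{for each index } k.$$ Introduce the random matrix $\mathbf{Y} = \sum_k \mathbf{X}_k$, and define $$\mu_{\min} = \lambda_{\min}(\mathbb{E}\,\mathbf{Y}) = \lambda_{\min}\Big( \sum_k \mathbb{E}\,\mathbf{X}_k \Big) \quad\text{and}\quad \mu_{\max} = \lambda_{\max}(\mathbb{E}\,\mathbf{Y}) = \lambda_{\max}\Big( \sum_k \mathbb{E}\,\mathbf{X}_k \Big).$$ Then, for $\theta > 0$, $$\mathbb{E}\,\lambda_{\min}(\mathbf{Y}) \geq \frac{1 - e^{-\theta}}{\theta}\, \mu_{\min} - \frac{1}{\theta} L \log d, \quad\text{and}\quad \mathbb{E}\,\lambda_{\max}(\mathbf{Y}) \leq \frac{e^{\theta} - 1}{\theta}\, \mu_{\max} + \frac{1}{\theta} L \log d.$$ Furthermore, $$\mathbb{P}\{ \lambda_{\min}(\mathbf{Y}) \leq (1-\varepsilon)\mu_{\min} \} \leq d \left[ \frac{e^{-\varepsilon}}{(1-\varepsilon)^{1-\varepsilon}} \right]^{\mu_{\min}/L} \quad\text{for } \varepsilon \in [0,1), \text{ and}$$ $$\mathbb{P}\{ \lambda_{\max}(\mathbf{Y}) \geq (1+\varepsilon)\mu_{\max} \} \leq d \left[ \frac{e^{\varepsilon}}{(1+\varepsilon)^{1+\varepsilon}}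 \right]^{\mu_{\max}/L} \quad\text{for } \varepsilon \geq 0.$$
   Context: For a Hermitian matrix $\mathbf{A}$, $\lambda_{\min}(\mathbf{A})$ and $\lambda_{\max}(\mathbf{A})$ are its algebraically smallest and largest eigenvalues. "Dimension $d$" means the matrices are $d \times d$ (complex Hermitian). $\log$ is the natural logarithm; expectations of matrices are entrywise. *)

theory Defs
  imports "HOL-Probability.Probability"
begin

definition hermitian :: "complex^'n^'n \<Rightarrow> bool" where
  "hermitian A \<longleftrightarrow> (\<forall>i j. A $ i $ j = cnj (A $ j $ i))"

definition eigenvalue :: "complex^'n^'n \<Rightarrow> complex \<Rightarrow> bool" where
  "eigenvalue A c \<longleftrightarrow> (\<exists>v. v \<noteq> 0 \<and> A *v v = c *s v)"

text \<open>
  The two extreme eigenvalues are meant for Hermitian matrices only, whose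
  eigenvalues are all real and form a finite nonempty set. For other matrices
  the sets below may omit nonreal eigenvalues or be empty.
\<close>

definition lambda_min :: "complex^'n^'n \<Rightarrow> real" where
  "lambda_min A = Min {x. eigenvalue A (complex_of_real x)}"

definition lambda_max :: "complex^'n^'n \<Rightarrow> real" where
  "lambda_max A = Max {x. eigenvalue A (complex_of_real x)}"

definition mat_expectation :: "'a measure \<Rightarrow> ('a \<Rightarrow> complex^'n^'n) \<Rightarrow> complex^'n^'n" where
  "mat_expectation M A = (\<chi> i j. \<integral>\<omega>. A \<omega> $ i $ j \<partial>M)"

end

theory Submission
  imports Defs
begin

text \<open>
  The Laplace transform bounds the extreme eigenvalues of \<open>Y = (\<Sum>k\<in>I. X k)\<close> by the trace of an
  exponential: \<open>exp (\<theta> * \<lambda>) \<le> Tr (exp (\<theta> Y))\<close> for each eigenvalue \<open>\<lambda>\<close> of \<open>Y\<close> and either sign of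
  \<open>\<theta>\<close>. All four estimates follow from one bound on the mean of this trace,
  \<open>E Tr (exp (\<theta> Y)) \<le> Tr (exp (c E Y))\<close> with \<open>c = (exp (\<theta> L) - 1) / L\<close>: the bounds on expectations by
  Jensen's inequality, the tails by Markov's inequality with the optimal \<open>\<theta> = ln (1 \<plusminus> \<epsilon>) / L\<close>.

  The trace bound is proved by replacing one summand at a time by its mean, so the heart of the
  matter is \<open>E Tr (exp (H + \<theta> X)) \<le> Tr (exp (H + c E X))\<close> for a fixed Hermitian \<open>H\<close>
  (\<open>tr_exp_expectation_le\<close>). For commuting matrices this is the chord bound
  \<open>exp (\<theta> x) \<le> 1 + c x\<close> followed by \<open>1 + c x \<le> exp (c x)\<close>. In general it is a consequence of Lieb's
  theorem that \<open>A \<mapsto> Tr (exp (H + ln A))\<close> is concave, and it is derived here from the joint convexity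
  of the quantum relative entropy \<open>D(T, B) = Tr (T ln T - T ln B - T + B)\<close>, as follows. Put
  \<open>T = exp (H + \<theta> X)\<close> and \<open>B = 1 + c X\<close>. Since \<open>ln B \<ge> \<theta> X\<close>, the entropy \<open>D(T, B)\<close> is at most
  \<open>Tr (T H) - Tr T + Tr B\<close>, which is linear in \<open>T\<close> and \<open>B\<close>. Convexity therefore gives the same bound for
  \<open>D(E T, E B)\<close>. Because \<open>ln (1 + c E X) \<le> c E X\<close>, this turns into a bound on the entropy of \<open>E T\<close>, which
  Gibbs' variational principle converts into \<open>Tr (E T) \<le> Tr (exp (H + c E X))\<close>.

  Joint convexity itself is elementary. Taylor's formula for \<open>x ln x\<close> writes \<open>D(T, B)\<close> as the integral
  over \<open>s\<close> in \<open>[0, 1]\<close>, with weight \<open>1 - s\<close>, of the quadratic expressions \<open>\<langle>T - B, ((1 - s) B + s T)\<^sup>-\<^sup>1 (T - B)\<rangle>\<close>, where \<open>B\<close> acts by left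
  and \<open>T\<close> by right multiplication; each of them is the maximum over \<open>V\<close> of
  \<open>2 Re \<langle>V, T - B\<rangle> - (1 - s) \<langle>V, B V\<rangle> - s \<langle>V, V T\<rangle>\<close>, and these are linear in \<open>(T, B)\<close>. Freezing the
  maximisers at \<open>(E T, E B)\<close> and integrating over \<open>s\<close> gives a linear functional below \<open>D\<close> that touches it
  there (\<open>rel_entropy_supporting_functional\<close>), so that taking expectations is all that convexity
  requires.
\<close>

section \<open>The spectral theorem for Hermitian matrices\<close>

definition adj :: "complex^'n^'m \<Rightarrow> complex^'m^'n" where
  "adj A = (\<chi> i j. cnj (A $ j $ i))"

definition diag :: "('n \<Rightarrow> real) \<Rightarrow> complex^'n^'n" where
  "diag l = (\<chi> i j. if i = j then complex_of_real (l i) else 0)"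

definition diagonalizes :: "complex^'n^'n \<Rightarrow> ('n \<Rightarrow> real) \<Rightarrow> complex^'n^'n \<Rightarrow> bool" where
  "diagonalizes U l A \<longleftrightarrow> adj U ** U = mat 1 \<and> A = U ** diag l ** adj U"

definition cinner :: "complex^'n \<Rightarrow> complex^'n \<Rightarrow> complex" where
  "cinner x y = (\<Sum>i\<in>UNIV. cnj (x $ i) * y $ i)"

lemma adj_nth [simp]: "adj A $ i $ j = cnj (A $ j $ i)"
  by (simp add: adj_def)

lemma adj_adj [simp]: "adj (adj A) = A"
  by (simp add: vec_eq_iff)

lemma adj_mult: "adj (A ** B) = adj B ** adj A"
  by (simp add: vec_eq_iff matrix_matrix_mult_def mult.commute)

lemma adj_diag [simp]: "adj (diag l) = diag l"
  by (simp add: vec_eq_iff diag_def)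

lemma hermitian_iff_adj: "hermitian A \<longleftrightarrow> adj A = A"
  unfolding hermitian_def vec_eq_iff adj_nth by (metis (no_types))

lemma inner_eq_Re_cinner: "inner x y = Re (cinner x y)"
  by (simp add: inner_vec_def cinner_def inner_complex_def)

lemma cinner_eq_0_iff: "cinner x y = 0 \<longleftrightarrow> inner x y = 0 \<and> inner (\<i> *s x) y = 0"
proof -
  have "cinner (\<i> *s x) y = - \<i> * cinner x y"
    by (simp add: cinner_def sum_distrib_left mult.assoc)
  then have "inner (\<i> *s x) y = Im (cinner x y)"
    by (simp add: inner_eq_Re_cinner)
  then show ?thesis
    by (simp add: inner_eq_Re_cinner complex_eq_iff)
qed

lemma cinner_mult_left: "cinner (A *v x) y = cinner x (adj A *v y)"
proof -
  have "cinner (A *v x) y = (\<Sum>i\<in>UNIV. \<Sum>j\<in>UNIV. cnj (A $ i $ j) * cnj (x $ j) * y $ i)"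
    by (simp add: cinner_def matrix_vector_mult_def sum_distrib_right)
  also have "\<dots> = (\<Sum>j\<in>UNIV. \<Sum>i\<in>UNIV. cnj (A $ i $ j) * cnj (x $ j) * y $ i)"
    by (rule sum.swap)
  also have "\<dots> = cinner x (adj A *v y)"
    by (simp add: cinner_def matrix_vector_mult_def sum_distrib_left mult_ac)
  finally show ?thesis .
qed

lemma cinner_simps:
  "cinner x (y - z) = cinner x y - cinner x z"
  "cinner x (y + z) = cinner x y + cinner x z"
  "cinner x (r *\<^sub>R y) = of_real r * cinner x y"
  "cinner (r *\<^sub>R x) y = of_real r * cinner x y"
  by (simp_all add: cinner_def sum_subtractf sum.distrib right_diff_distrib distrib_left
      sum_distrib_left scaleR_conv_of_real[where 'a=complex] mult_ac)

lemma mult_scaleR_vec [simp]: "(A::complex^'n^'m) *v (r *\<^sub>R x) = r *\<^sub>R (A *v x)"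
  by (simp add: vec_eq_iff matrix_vector_mult_def scaleR_sum_right)

lemma continuous_on_matrix_vector: "continuous_on S (\<lambda>x. (A::complex^'n^'m) *v x)"
  unfolding matrix_vector_mult_def by (intro continuous_intros)

text \<open>
  The maximiser of the quadratic form on the unit sphere of an invariant subspace is an
  eigenvector: the residual of the eigenvalue equation lies in the subspace, and moving along
  it would otherwise increase the form to first order.
\<close>

lemma hermitian_eigenvector_orthogonal_to:
  fixes A :: "complex^'n^'n"
  assumes A: "hermitian A"
    and U: "\<And>u. u \<in> U \<Longrightarrow> \<exists>l::real. A *v u = l *\<^sub>R u"
    and x0: "x0 \<noteq> 0" "\<And>u. u \<in> U \<Longrightarrow> cinner u x0 = 0"
  obtains x l where "norm x = 1" "\<And>u. u \<in> U \<Longrightarrow> cinner u x = 0" "A *v x = (l::real) *\<^sub>R x"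
proof -
  define W where "W = {x. \<forall>u\<in>U. cinner u x = 0}"
  have AW: "A *v x \<in> W" if "x \<in> W" for x
  proof -
    have "cinner u (A *v x) = 0" if u: "u \<in> U" for u
    proof -
      obtain l where l: "A *v u = l *\<^sub>R u" using U u by blast
      have "cinner u (A *v x) = cinner (A *v u) x"
        using A by (simp add: cinner_mult_left hermitian_iff_adj)
      then show ?thesis using l \<open>x \<in> W\<close> u by (simp add: cinner_simps W_def)
    qed
    then show ?thesis by (simp add: W_def)
  qed
  have W_add: "x + r *\<^sub>R y \<in> W" if "x \<in> W" "y \<in> W" for x y r
    using that by (simp add: W_def cinner_simps)
  have W_scale: "r *\<^sub>R y \<in> W" if "y \<in> W" for y r
    using that by (simp add: W_def cinner_simps)
  have "closed W"
  proof -
    have "continuous_on UNIV (\<lambda>x. cinner u x)" for u :: "complex^'n"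
      unfolding cinner_def by (intro continuous_intros)
    moreover have "W = (\<Inter>u\<in>U. {x. cinner u x = 0})" by (auto simp: W_def)
    ultimately show ?thesis
      by (auto intro!: closed_INT closed_Collect_eq continuous_intros)
  qed
  then have "compact (W \<inter> sphere 0 1)"
    by (metis compact_sphere inf_commute compact_Int_closed)
  moreover have "W \<inter> sphere 0 1 \<noteq> {}"
  proof -
    have "(1 / norm x0) *\<^sub>R x0 \<in> W \<inter> sphere 0 1"
      using x0 by (auto simp: W_def cinner_simps)
    then show ?thesis by blast
  qed
  moreover have "continuous_on (W \<inter> sphere 0 1) (\<lambda>x. inner x (A *v x))"
    by (intro continuous_intros continuous_on_matrix_vector)
  ultimately obtain x where x: "x \<in> W \<inter> sphere 0 1"
    and xmax: "\<And>y. y \<in> W \<inter> sphere 0 1 \<Longrightarrow> inner y (A *v y) \<le> inner x (A *v x)"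
    using continuous_attains_sup[of "W \<inter> sphere 0 1" "\<lambda>x. inner x (A *v x)"] by blast
  define l where "l = inner x (A *v x)"
  have xW: "x \<in> W" and nx: "norm x = 1" using x by auto
  have quad: "inner y (A *v y) \<le> l * (norm y)\<^sup>2" if "y \<in> W" for y
  proof (cases "y = 0")
    case False
    let ?y = "(1 / norm y) *\<^sub>R y"
    have "inner ?y (A *v ?y) \<le> l"
      unfolding l_def by (rule xmax) (use False W_scale[OF that] in auto)
    then have "inner y (A *v y) / (norm y)\<^sup>2 \<le> l"
      by (simp add: mult_scaleR_vec power2_eq_square)
    then show ?thesis using False by (simp add: divide_le_eq)
  qed simp
  define z where "z = A *v x - l *\<^sub>R x"
  have zW: "z \<in> W" using W_add[OF AW[OF xW] xW, of "-l"] by (simp add: z_def)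
  have sym: "inner x (A *v z) = inner z (A *v x)"
  proof -
    have "inner x (A *v z) = inner (A *v x) z"
      using A by (simp add: inner_eq_Re_cinner cinner_mult_left hermitian_iff_adj)
    then show ?thesis by (simp add: inner_commute)
  qed
  define N C where "N = inner z z" and "C = l * (norm z)\<^sup>2 - inner z (A *v z)"
  have ineq: "2 * h * N \<le> h\<^sup>2 * C" for h :: real
  proof -
    have "inner (x + h *\<^sub>R z) (A *v (x + h *\<^sub>R z)) = l + 2 * h * inner z (A *v x) + h\<^sup>2 * inner z (A *v z)"
      by (simp add: matrix_vector_right_distrib mult_scaleR_vec inner_add_left inner_add_right sym
          l_def power2_eq_square distrib_left mult.assoc del: matrix_vector_mult_scaleR)
    moreover have "(norm (x + h *\<^sub>R z))\<^sup>2 = 1 + 2 * h * inner z x + h\<^sup>2 * (norm z)\<^sup>2"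
      using nx unfolding power2_norm_eq_inner norm_eq_1
      by (simp add: inner_add_left inner_add_right inner_commute power2_eq_square algebra_simps)
    moreover have "N = inner z (A *v x) - l * inner z x"
      by (simp add: N_def z_def inner_diff_right)
    ultimately show ?thesis
      using quad[OF W_add[OF xW zW, of h]]
      by (simp add: C_def right_diff_distrib distrib_left mult_ac)
  qed
  have "N = 0"
  proof (rule ccontr)
    assume "N \<noteq> 0"
    then have N: "N > 0" by (simp add: N_def)
    have C0: "0 \<le> C" using quad[OF zW] by (simp add: C_def)
    \<comment> \<open>a step so short that the second-order term cannot compensate the gain\<close>
    define h where "h = N / (C + 1)"
    have h: "h > 0" using N C0 by (simp add: h_def)
    have "2 * N \<le> h * C"
      using ineq[of h] h by (simp add: power2_eq_square mult.assoc)
    also have "\<dots> \<le> N" using N C0 by (simp add: h_def field_simps)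
    finally show False using N by simp
  qed
  then have "A *v x = l *\<^sub>R x" by (simp add: N_def z_def)
  then show ?thesis using that[of x l] nx xW by (auto simp: W_def)
qed

lemma hermitian_orthonormal_eigenvectors:
  fixes A :: "complex^'n^'n"
  assumes A: "hermitian A" and "k \<le> CARD('n)"
  shows "\<exists>U. finite U \<and> card U = k \<and> (\<forall>u\<in>U. norm u = 1 \<and> (\<exists>l::real. A *v u = l *\<^sub>R u))
    \<and> (\<forall>u\<in>U. \<forall>v\<in>U. u \<noteq> v \<longrightarrow> cinner u v = 0)"
  using assms(2)
proof (induction k)
  case 0
  show ?case by (intro exI[of _ "{}"]) auto
next
  case (Suc k)
  then obtain U where U: "finite U" "card U = k"
    "\<And>u. u \<in> U \<Longrightarrow> norm u = 1 \<and> (\<exists>l::real. A *v u = l *\<^sub>R u)"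
    "\<And>u v. u \<in> U \<Longrightarrow> v \<in> U \<Longrightarrow> u \<noteq> v \<Longrightarrow> cinner u v = 0" by auto
  \<comment> \<open>The complex orthogonal complement of \<open>U\<close> is the real one of \<open>U\<close> and \<open>\<i> U\<close> together.\<close>
  define S where "S = U \<union> (\<lambda>u. \<i> *s u) ` U"
  have "dim S \<le> card S"
    using U(1) by (intro dim_le_card') (auto simp: S_def)
  also have "\<dots> \<le> k + k"
    unfolding S_def using card_Un_le[of U "(\<lambda>u. \<i> *s u) ` U"] card_image_le[OF U(1), of "\<lambda>u. \<i> *s u"] U(2)
    by linarith
  also have "\<dots> < DIM(complex^'n)" using Suc.prems by simp
  finally obtain x0 where x0: "x0 \<noteq> 0" "\<And>y. y \<in> span S \<Longrightarrow> orthogonal x0 y"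
    using orthogonal_to_subspace_exists by blast
  have "cinner u x0 = 0" if "u \<in> U" for u
    using x0(2)[of u] x0(2)[of "\<i> *s u"] that
    by (auto simp: cinner_eq_0_iff S_def orthogonal_def inner_commute intro: span_base)
  with x0(1) obtain x l where x: "norm x = 1" "\<And>u. u \<in> U \<Longrightarrow> cinner u x = 0" "A *v x = (l::real) *\<^sub>R x"
    using hermitian_eigenvector_orthogonal_to[OF A, of U x0] U(3) by blast
  have "x \<notin> U"
  proof
    assume "x \<in> U"
    then have "inner x x = 0" using x(2)[of x] by (simp add: inner_eq_Re_cinner)
    then show False using x(1) by auto
  qed
  moreover have "cinner x u = 0" if "u \<in> U" for u
  proof -
    have "cinner x u = cnj (cinner u x)" by (simp add: cinner_def mult.commute)
    then show ?thesis using x(2)[OF that] by simp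
  qed
  ultimately show ?case
    using U x by (intro exI[of _ "insert x U"]) auto
qed

lemma adj_mult_self_nth: "(adj U ** V) $ i $ j = cinner (column i U) (column j V)"
  by (simp add: matrix_matrix_mult_def cinner_def column_def)

lemma mult_diag_nth: "(A ** diag l) $ i $ j = A $ i $ j * complex_of_real (l j)"
  by (simp add: matrix_matrix_mult_def diag_def if_distrib[of "\<lambda>x. _ * x"] cong: if_cong)

lemma diag_mult_nth: "(diag l ** A) $ i $ j = complex_of_real (l i) * A $ i $ j"
  by (simp add: matrix_matrix_mult_def diag_def if_distrib[of "\<lambda>x. x * _"] cong: if_cong)

lemma adj_mult_eq_one_commute: "adj U ** U = mat 1 \<Longrightarrow> U ** adj U = (mat 1 :: complex^'n^'n)"
  for U :: "complex^'n^'n"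
  using matrix_left_right_inverse by blast

theorem spectral_theorem:
  fixes A :: "complex^'n^'n"
  assumes A: "hermitian A"
  obtains U l where "diagonalizes U l A"
proof -
  obtain S where S: "finite S" "card S = CARD('n)"
    "\<And>u. u \<in> S \<Longrightarrow> norm u = 1 \<and> (\<exists>l::real. A *v u = l *\<^sub>R u)"
    "\<And>u v. u \<in> S \<Longrightarrow> v \<in> S \<Longrightarrow> u \<noteq> v \<Longrightarrow> cinner u v = 0"
    using hermitian_orthonormal_eigenvectors[OF A order.refl] by metis
  obtain f :: "'n \<Rightarrow> complex^'n" where f: "bij_betw f UNIV S"
    using finite_same_card_bij[of "UNIV::'n set" S] S by auto
  have fS: "f i \<in> S" for i using f by (auto simp: bij_betw_def)
  obtain l where l: "\<And>i. A *v f i = (l i :: real) *\<^sub>R f i"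
    using S(3)[OF fS] by metis
  define U :: "complex^'n^'n" where "U = (\<chi> i j. f j $ i)"
  have col: "column j U = f j" for j by (simp add: U_def column_def vec_eq_iff)
  have ff: "cinner (f i) (f j) = (if i = j then 1 else 0)" for i j
  proof (cases "i = j")
    case True
    have "Re (cinner (f i) (f i)) = 1"
      using S(3)[OF fS, of i] by (simp add: inner_eq_Re_cinner[symmetric] norm_eq_1)
    moreover have "Im (cinner (f i) (f i)) = 0" by (simp add: cinner_def Im_sum)
    ultimately show ?thesis using True by (simp add: complex_eq_iff)
  next
    case False
    then have "f i \<noteq> f j" using f by (auto simp: bij_betw_def inj_on_def)
    then show ?thesis using S(4)[OF fS fS] False by simp
  qed
  have UU: "adj U ** U = mat 1"
    by (simp add: vec_eq_iff adj_mult_self_nth col ff mat_def)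
  have "A ** U = U ** diag l"
  proof -
    have "(A ** U) $ i $ j = (U ** diag l) $ i $ j" for i j
    proof -
      have "(A ** U) $ i $ j = (A *v f j) $ i"
        by (simp add: matrix_matrix_mult_def matrix_vector_mult_def U_def)
      also have "\<dots> = (U ** diag l) $ i $ j"
        by (subst l) (simp add: mult_diag_nth U_def scaleR_conv_of_real[where 'a=complex] mult.commute)
      finally show ?thesis .
    qed
    then show ?thesis by (simp add: vec_eq_iff)
  qed
  then have "A = U ** diag l ** adj U"
    using adj_mult_eq_one_commute[OF UU] by (metis matrix_mul_assoc matrix_mul_rid)
  with UU show ?thesis using that by (auto simp: diagonalizes_def)
qed

lemma diagonalizes_hermitian: "diagonalizes U l A \<Longrightarrow> hermitian A"
  by (simp add: diagonalizes_def hermitian_iff_adj adj_mult matrix_mul_assoc)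

lemma diagonalizes_conj:
  assumes "diagonalizes U l A"
  shows "adj U ** A ** U = diag l"
proof -
  have UU: "adj U ** U = mat 1" and A: "A = U ** diag l ** adj U"
    using assms by (auto simp: diagonalizes_def)
  have "adj U ** A ** U = (adj U ** U) ** diag l ** (adj U ** U)"
    unfolding A by (simp only: matrix_mul_assoc)
  then show ?thesis by (simp add: UU)
qed

lemma eigenvalues_diagonalizes:
  fixes A :: "complex^'n^'n"
  assumes "diagonalizes U l A"
  shows "{x. eigenvalue A (complex_of_real x)} = range l"
proof -
  have UU: "adj U ** U = mat 1" and UU': "U ** adj U = mat 1" and A: "A = U ** diag l ** adj U"
    using assms adj_mult_eq_one_commute by (auto simp: diagonalizes_def)
  have "eigenvalue A (complex_of_real (l k))" for k
  proof -
    have "A ** U = U ** diag l ** (adj U ** U)"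
      unfolding A by (simp only: matrix_mul_assoc)
    then have "A ** U = U ** diag l" by (simp add: UU)
    moreover have "(A *v column k U) $ i = (A ** U) $ i $ k" for i
      by (simp add: matrix_matrix_mult_def matrix_vector_mult_def column_def)
    ultimately have "A *v column k U = complex_of_real (l k) *s column k U"
      by (simp add: vec_eq_iff mult_diag_nth column_def mult.commute)
    moreover have "column k U \<noteq> 0"
    proof
      assume "column k U = 0"
      then have "(adj U ** U) $ k $ k = 0" by (simp add: adj_mult_self_nth cinner_def)
      then show False by (simp add: UU mat_def)
    qed
    ultimately show ?thesis by (auto simp: eigenvalue_def)
  qed
  moreover have "x \<in> range l" if ev: "eigenvalue A (complex_of_real x)" for x
  proof -
    obtain v where v: "v \<noteq> 0" "A *v v = complex_of_real x *s v" using ev by (auto simp: eigenvalue_def)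
    define w where "w = adj U *v v"
    have "U *v w = v" by (simp add: w_def matrix_vector_mul_assoc UU')
    then have "w \<noteq> 0" using v(1) by auto
    then obtain k where k: "w $ k \<noteq> 0" by (auto simp: vec_eq_iff)
    have "adj U ** A = (adj U ** U) ** diag l ** adj U"
      unfolding A by (simp only: matrix_mul_assoc)
    then have "adj U ** A = diag l ** adj U" by (simp add: UU)
    then have "diag l *v w = adj U *v (A *v v)" by (simp add: w_def matrix_vector_mul_assoc)
    also have "\<dots> = complex_of_real x *s w" by (simp add: v(2) w_def vec.scale)
    finally have "(diag l *v w) $ k = complex_of_real x * w $ k" by simp
    moreover have "(diag l *v w) $ k = complex_of_real (l k) * w $ k"
      by (simp add: matrix_vector_mult_def diag_def if_distrib[of "\<lambda>x. x * _"] cong: if_cong)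
    ultimately show ?thesis using k by auto
  qed
  ultimately show ?thesis by blast
qed

lemma lambda_max_diagonalizes: "diagonalizes U l A \<Longrightarrow> lambda_max A = Max (range l)"
  by (simp add: lambda_max_def eigenvalues_diagonalizes)

lemma lambda_min_diagonalizes: "diagonalizes U l A \<Longrightarrow> lambda_min A = Min (range l)"
  by (simp add: lambda_min_def eigenvalues_diagonalizes)

section \<open>Traces and Frobenius norms in eigenbases\<close>

lemma adj_mult_cancel:
  fixes U :: "complex^'n^'n"
  assumes "adj U ** U = mat 1"
  shows "adj U ** (U ** V) = V"
  by (simp add: assms matrix_mul_assoc)

lemma adj_mult_unitary:
  fixes E F :: "complex^'n^'n"
  assumes "adj E ** E = mat 1" "adj F ** F = mat 1"
  shows "adj (adj F ** E) ** (adj F ** E) = mat 1"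
proof -
  have "adj (adj F ** E) ** (adj F ** E) = adj E ** (F ** adj F) ** E"
    by (simp add: adj_mult matrix_mul_assoc)
  then show ?thesis by (simp add: assms adj_mult_eq_one_commute)
qed

lemma of_real_cmod_power2: "(complex_of_real (cmod z))\<^sup>2 = z * cnj z"
  using complex_norm_square[of z] by simp

lemma unitary_column_sum:
  fixes w :: "complex^'n^'n"
  assumes "adj w ** w = mat 1"
  shows "(\<Sum>j\<in>UNIV. (cmod (w $ j $ i))\<^sup>2) = 1"
proof -
  have "complex_of_real (\<Sum>j\<in>UNIV. (cmod (w $ j $ i))\<^sup>2) = (adj w ** w) $ i $ i"
    by (simp add: matrix_matrix_mult_def of_real_cmod_power2 mult.commute)
  also have "\<dots> = 1" by (simp add: assms mat_def)
  finally show ?thesis by (simp only: of_real_eq_1_iff)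
qed

lemma unitary_row_sum:
  fixes w :: "complex^'n^'n"
  assumes "adj w ** w = mat 1"
  shows "(\<Sum>i\<in>UNIV. (cmod (w $ j $ i))\<^sup>2) = 1"
  using unitary_column_sum[of "adj w" j] adj_mult_eq_one_commute[OF assms] by simp

lemma trace_three:
  "trace (adj v ** diag b ** w) = (\<Sum>i\<in>UNIV. \<Sum>j\<in>UNIV. cnj (v $ j $ i) * complex_of_real (b j) * w $ j $ i)"
  for v w :: "complex^'n^'n"
  unfolding trace_def matrix_matrix_mult_def[of "adj v ** diag b"]
  by (simp add: mult_diag_nth)

lemma trace_two:
  "trace (adj v ** w ** diag t) = (\<Sum>i\<in>UNIV. \<Sum>j\<in>UNIV. cnj (v $ j $ i) * complex_of_real (t i) * w $ j $ i)"
  for v w :: "complex^'n^'n"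
  by (simp add: trace_def mult_diag_nth, simp add: matrix_matrix_mult_def sum_distrib_left sum_distrib_right mult_ac)

text \<open>
  The squared moduli of the overlaps between two eigenbases form a doubly stochastic matrix, and
  the trace of a product is the mean of the products of eigenvalues under these weights. This is
  how inequalities between numbers carry over to pairs of matrices that do not commute.
\<close>

lemma trace_mult_diagonalizes:
  fixes T X :: "complex^'n^'n"
  assumes T: "diagonalizes E t T" and X: "diagonalizes F x X"
  shows "Re (trace (T ** X)) =
    (\<Sum>i\<in>UNIV. \<Sum>j\<in>UNIV. (cmod ((adj F ** E) $ j $ i))\<^sup>2 * (t i * x j))"
proof -
  define w where "w = adj F ** E"
  have "trace (T ** X) = trace (E ** (diag t ** adj E ** F ** diag x ** adj F))"
    using T X by (simp add: diagonalizes_def matrix_mul_assoc)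
  also have "\<dots> = trace (diag t ** adj E ** F ** diag x ** adj F ** E)"
    by (rule trace_mul_sym)
  also have "\<dots> = trace (adj (w ** diag t) ** diag x ** w)"
    by (simp add: w_def adj_mult matrix_mul_assoc)
  also have "\<dots> = (\<Sum>i\<in>UNIV. \<Sum>j\<in>UNIV. complex_of_real ((cmod (w $ j $ i))\<^sup>2 * (t i * x j)))"
    unfolding trace_three by (simp add: mult_diag_nth of_real_cmod_power2 mult_ac)
  finally show ?thesis by (simp add: w_def)
qed

lemma trace_diagonalizes:
  fixes T :: "complex^'n^'n"
  assumes T: "diagonalizes E t T"
  shows "Re (trace T) = (\<Sum>i\<in>UNIV. t i)"
proof -
  have "trace T = trace (E ** (diag t ** adj E))"
    using T by (simp add: diagonalizes_def matrix_mul_assoc)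
  also have "\<dots> = trace (diag t ** (adj E ** E))"
    by (subst trace_mul_sym) (simp add: matrix_mul_assoc)
  also have "\<dots> = trace (diag t)" using T by (simp add: diagonalizes_def)
  finally show ?thesis by (simp add: trace_def diag_def)
qed

text \<open>
  The norm on matrices is the Frobenius norm, whose square is the trace of \<open>A\<^sup>* A\<close>.
\<close>

lemma norm_diagonalizes:
  fixes A :: "complex^'n^'n"
  assumes "diagonalizes U l A"
  shows "(norm A)\<^sup>2 = (\<Sum>i\<in>UNIV. (l i)\<^sup>2)"
proof -
  have UU: "adj U ** U = mat 1" and A: "A = U ** diag l ** adj U"
    using assms by (auto simp: diagonalizes_def)
  have "A ** A = U ** diag l ** (adj U ** U) ** diag l ** adj U"
    unfolding A by (simp only: matrix_mul_assoc)
  also have "\<dots> = U ** (diag l ** diag l) ** adj U" by (simp add: UU matrix_mul_assoc)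
  also have "diag l ** diag l = diag (\<lambda>i. (l i)\<^sup>2)"
    by (simp add: vec_eq_iff mult_diag_nth) (simp add: diag_def power2_eq_square)
  finally have "diagonalizes U (\<lambda>i. (l i)\<^sup>2) (A ** A)" using UU by (simp add: diagonalizes_def)
  then have "(\<Sum>i\<in>UNIV. (l i)\<^sup>2) = Re (trace (A ** A))" by (simp add: trace_diagonalizes)
  also have "A ** A = adj A ** A" using diagonalizes_hermitian[OF assms] by (simp add: hermitian_iff_adj)
  also have "trace (adj A ** A) = complex_of_real (\<Sum>i\<in>UNIV. \<Sum>j\<in>UNIV. (cmod (A $ j $ i))\<^sup>2)"
    by (simp add: trace_def matrix_matrix_mult_def of_real_cmod_power2 mult.commute)
  also have "(\<Sum>i\<in>UNIV. \<Sum>j\<in>UNIV. (cmod (A $ j $ i))\<^sup>2) = (\<Sum>j\<in>UNIV. \<Sum>i\<in>UNIV. (cmod (A $ j $ i))\<^sup>2)"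
    by (rule sum.swap)
  also have "\<dots> = (norm A)\<^sup>2"
    by (simp add: norm_vec_def L2_set_def sum_nonneg)
  finally show ?thesis by simp
qed

lemma abs_eigenvalue_le_norm:
  assumes "diagonalizes U l A"
  shows "\<bar>l k\<bar> \<le> norm A"
proof -
  have "(l k)\<^sup>2 \<le> (\<Sum>i\<in>UNIV. (l i)\<^sup>2)" by (rule member_le_sum) auto
  then have "\<bar>l k\<bar>\<^sup>2 \<le> (norm A)\<^sup>2" using norm_diagonalizes[OF assms] by simp
  then show ?thesis by (rule power2_le_imp_le) simp
qed

lemma norm_le_sum_abs_eigenvalues:
  assumes "diagonalizes U l A"
  shows "norm A \<le> (\<Sum>i\<in>UNIV. \<bar>l i\<bar>)"
proof -
  have "norm A = L2_set l UNIV"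
    using norm_diagonalizes[OF assms] by (simp add: L2_set_def real_sqrt_unique)
  then show ?thesis by (simp add: L2_set_le_sum_abs)
qed

text \<open>
  Diagonal entries of a Hermitian matrix in any orthonormal basis are convex combinations of its
  eigenvalues.
\<close>

lemma diagonal_entry_between:
  fixes A U :: "complex^'n^'n"
  assumes A: "diagonalizes E t A" and U: "adj U ** U = mat 1" and t: "\<And>i. a \<le> t i" "\<And>i. t i \<le> b"
  shows "a \<le> Re ((adj U ** A ** U) $ k $ k)" and "Re ((adj U ** A ** U) $ k $ k) \<le> b"
proof -
  have EE: "adj E ** E = mat 1" using A by (simp add: diagonalizes_def)
  define w where "w = adj E ** U"
  have w: "(\<Sum>j\<in>UNIV. (cmod (w $ j $ k))\<^sup>2) = 1"
    unfolding w_def by (intro unitary_column_sum adj_mult_unitary U EE)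
  have "adj U ** A ** U = adj w ** (diag t ** w)"
    using A by (simp add: diagonalizes_def w_def adj_mult matrix_mul_assoc)
  then have "(adj U ** A ** U) $ k $ k = complex_of_real (\<Sum>j\<in>UNIV. (cmod (w $ j $ k))\<^sup>2 * t j)"
    by (simp add: matrix_matrix_mult_def[of "adj w"] diag_mult_nth of_real_cmod_power2 mult_ac)
  then have eq: "Re ((adj U ** A ** U) $ k $ k) = (\<Sum>j\<in>UNIV. (cmod (w $ j $ k))\<^sup>2 * t j)" by simp
  have "a = (\<Sum>j\<in>UNIV. (cmod (w $ j $ k))\<^sup>2 * a)" using w by (simp flip: sum_distrib_right)
  also have "\<dots> \<le> (\<Sum>j\<in>UNIV. (cmod (w $ j $ k))\<^sup>2 * t j)"
    by (intro sum_mono mult_left_mono t) simp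
  finally show "a \<le> Re ((adj U ** A ** U) $ k $ k)" using eq by simp
  have "(\<Sum>j\<in>UNIV. (cmod (w $ j $ k))\<^sup>2 * t j) \<le> (\<Sum>j\<in>UNIV. (cmod (w $ j $ k))\<^sup>2 * b)"
    by (intro sum_mono mult_left_mono t) simp
  also have "\<dots> = b" using w by (simp flip: sum_distrib_right)
  finally show "Re ((adj U ** A ** U) $ k $ k) \<le> b" using eq by simp
qed

section \<open>Joint convexity of the relative entropy\<close>

text \<open>
  For matrices \<open>T\<close> and \<open>B\<close> with eigenvalues \<open>t\<close> and \<open>b\<close> and overlaps \<open>w\<close> between their eigenbases, this
  is \<open>Tr (T ln T - T ln B - T + B)\<close>. Working with spectral data avoids the matrix logarithm.
\<close>

definition rel_entropy :: "complex^'n^'n \<Rightarrow> ('n \<Rightarrow> real) \<Rightarrow> ('n \<Rightarrow> real) \<Rightarrow> real" where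
  "rel_entropy w t b =
    (\<Sum>i\<in>UNIV. \<Sum>j\<in>UNIV. (cmod (w $ j $ i))\<^sup>2 * (t i * (ln (t i) - ln (b j)) - t i + b j))"

lemma scalar_rel_entropy_nonneg:
  fixes t b :: real
  assumes "0 < t" "0 < b"
  shows "0 \<le> t * (ln t - ln b) - t + b"
proof -
  have "ln (b / t) \<le> b / t - 1" using assms by (intro ln_le_minus_one) auto
  then have "t * (ln b - ln t) \<le> t * (b / t - 1)" using assms by (intro mult_left_mono) (auto simp: ln_div)
  also have "\<dots> = b - t" using assms by (simp add: field_simps)
  finally show ?thesis by (simp add: algebra_simps)
qed

lemma segment_pos:
  fixes b t s :: real
  assumes "0 < t" "0 < b" "s \<in> {0..1}"
  shows "0 < (1 - s) * b + s * t"
proof (cases "s = 0")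
  case False
  then have "0 < s * t" "0 \<le> (1 - s) * b" using assms by auto
  then show ?thesis by linarith
qed (use assms in simp)

text \<open>Taylor's formula with integral remainder for \<open>x * ln x\<close>, expanded at \<open>b\<close>.\<close>

lemma scalar_rel_entropy_integral:
  fixes t b :: real
  assumes "0 < t" "0 < b"
  shows "((\<lambda>s. (1 - s) * ((t - b)\<^sup>2 / ((1 - s) * b + s * t))) has_integral
    t * (ln t - ln b) - t + b) {0..1}"
proof -
  define m where "m = (\<lambda>s. (1 - s) * b + s * t)"
  \<comment> \<open>obtained by integrating \<open>(1 - s) * ((t - b) * ln (m s))'\<close> by parts\<close>
  define F where "F = (\<lambda>s. (1 - s) * (t - b) * ln (m s) + m s * ln (m s) - m s)"
  have "((\<lambda>s. (1 - s) * ((t - b)\<^sup>2 / m s)) has_integral F 1 - F 0) {0..1}"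
  proof (rule fundamental_theorem_of_calculus)
    fix s :: real assume s: "s \<in> {0..1}"
    have m: "0 < m s" unfolding m_def by (rule segment_pos) (use assms s in auto)
    have dm: "(m has_real_derivative (t - b)) (at s within {0..1})"
      unfolding m_def by (auto intro!: derivative_eq_intros)
    have "(F has_real_derivative
        (1 - s) * (t - b) * ((t - b) / m s) - (t - b) * ln (m s)
        + (m s * ((t - b) / m s) + (t - b) * ln (m s)) - (t - b)) (at s within {0..1})"
      unfolding F_def
      by (rule derivative_eq_intros dm refl m | simp add: divide_inverse algebra_simps)+
    moreover have "m s * ((t - b) / m s) = t - b" using m by simp
    moreover have "(1 - s) * (t - b) * ((t - b) / m s) - x + (y + x) - y = (1 - s) * ((t - b)\<^sup>2 / m s)"
      for x y by (simp add: power2_eq_square)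
    ultimately have "(F has_real_derivative (1 - s) * ((t - b)\<^sup>2 / m s)) (at s within {0..1})"
      by (simp only:)
    then show "(F has_vector_derivative (1 - s) * ((t - b)\<^sup>2 / m s)) (at s within {0..1})"
      by (simp add: has_real_derivative_iff_has_vector_derivative)
  qed simp
  moreover have "F 1 - F 0 = t * (ln t - ln b) - t + b"
    by (simp add: F_def m_def algebra_simps)
  ultimately show ?thesis by (simp add: m_def)
qed

text \<open>
  For fixed \<open>V\<close> this is linear in the pair \<open>(T, B)\<close>; its maximum over \<open>V\<close> is the integrand of the
  relative entropy, which explains why that integrand is convex.
\<close>

definition var_form :: "real \<Rightarrow> complex^'n^'n \<Rightarrow> complex^'n^'n \<Rightarrow> complex^'n^'n \<Rightarrow> real" where
  "var_form s V T B = 2 * Re (trace (adj V ** (T - B)))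
    - (1 - s) * Re (trace (adj V ** B ** V)) - s * Re (trace (V ** T ** adj V))"

lemma matrix_diff_ldistrib: "A ** (B - C) = A ** B - A ** (C :: complex^'n^'m)"
  by (simp add: vec_eq_iff matrix_matrix_mult_def sum_subtractf right_diff_distrib)

lemma matrix_add_rdistrib: "(B + C) ** A = B ** A + C ** (A :: complex^'n^'m)"
  by (simp add: vec_eq_iff matrix_matrix_mult_def sum.distrib distrib_right)

lemma var_form_diagonalizes:
  fixes T B v :: "complex^'n^'n"
  assumes T: "diagonalizes E t T" and B: "diagonalizes F b B"
  shows "var_form s (F ** v ** adj E) T B = (\<Sum>i\<in>UNIV. \<Sum>j\<in>UNIV.
    2 * (t i - b j) * Re (cnj (v $ j $ i) * (adj F ** E) $ j $ i)
    - ((1 - s) * b j + s * t i) * (cmod (v $ j $ i))\<^sup>2)"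
proof -
  define w where "w = adj F ** E"
  define V where "V = F ** v ** adj E"
  have EE: "adj E ** E = mat 1" and FF: "adj F ** F = mat 1"
    and T': "T = E ** diag t ** adj E" and B': "B = F ** diag b ** adj F"
    using T B by (auto simp: diagonalizes_def)
  note cancel = adj_mult_cancel[OF EE] adj_mult_cancel[OF FF]
  have "trace (adj V ** T) = trace (E ** (adj v ** w ** diag t ** adj E))"
    by (simp add: V_def T' w_def adj_mult matrix_mul_assoc)
  also have "\<dots> = trace (adj v ** w ** diag t)"
    by (subst trace_mul_sym) (simp add: EE cancel matrix_mul_assoc[symmetric])
  finally have 1: "trace (adj V ** T) =
    (\<Sum>i\<in>UNIV. \<Sum>j\<in>UNIV. cnj (v $ j $ i) * complex_of_real (t i) * w $ j $ i)"
    by (simp add: trace_two)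
  have "trace (adj V ** B) = trace (E ** (adj v ** diag b ** adj F))"
    by (simp add: V_def B' adj_mult matrix_mul_assoc[symmetric] cancel)
  also have "\<dots> = trace (adj v ** diag b ** w)"
    by (subst trace_mul_sym) (simp add: w_def matrix_mul_assoc[symmetric])
  finally have 2: "trace (adj V ** B) =
    (\<Sum>i\<in>UNIV. \<Sum>j\<in>UNIV. cnj (v $ j $ i) * complex_of_real (b j) * w $ j $ i)"
    by (simp add: trace_three)
  have "trace (adj V ** B ** V) = trace (E ** (adj v ** diag b ** v ** adj E))"
    by (simp add: V_def B' adj_mult matrix_mul_assoc[symmetric] cancel)
  also have "\<dots> = trace (adj v ** diag b ** v)"
    by (subst trace_mul_sym) (simp add: EE matrix_mul_assoc[symmetric])
  finally have 3: "trace (adj V ** B ** V) =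
    (\<Sum>i\<in>UNIV. \<Sum>j\<in>UNIV. complex_of_real (b j * (cmod (v $ j $ i))\<^sup>2))"
    by (simp add: trace_three of_real_cmod_power2 mult_ac)
  have "trace (V ** T ** adj V) = trace (F ** (v ** diag t ** adj v ** adj F))"
    by (simp add: V_def T' adj_mult matrix_mul_assoc[symmetric] cancel)
  also have "\<dots> = trace (v ** (diag t ** adj v))"
    by (subst trace_mul_sym) (simp add: FF matrix_mul_assoc[symmetric])
  also have "\<dots> = trace (adj v ** v ** diag t)"
    by (subst (1 2) trace_mul_sym) (simp add: matrix_mul_assoc)
  finally have 4: "trace (V ** T ** adj V) =
    (\<Sum>i\<in>UNIV. \<Sum>j\<in>UNIV. complex_of_real (t i * (cmod (v $ j $ i))\<^sup>2))"
    by (simp add: trace_two of_real_cmod_power2 mult_ac)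
  have "2 * Re (trace (adj V ** (T - B))) =
    (\<Sum>i\<in>UNIV. \<Sum>j\<in>UNIV. 2 * (t i - b j) * Re (cnj (v $ j $ i) * w $ j $ i))"
    by (simp add: matrix_diff_ldistrib trace_sub 1 2 sum_distrib_left flip: sum_subtractf)
       (simp add: algebra_simps)
  then show ?thesis
    unfolding var_form_def V_def[symmetric] w_def[symmetric] 3 4
    by (simp add: sum_distrib_left sum_subtractf sum.distrib algebra_simps)
qed

text \<open>Completing the square.\<close>

lemma scalar_var_form_le:
  fixes d m :: real and v w :: complex
  assumes "0 < m"
  shows "2 * d * Re (cnj v * w) - m * (cmod v)\<^sup>2 \<le> (cmod w)\<^sup>2 * (d\<^sup>2 / m)"
proof -
  have "0 \<le> (cmod (of_real d * w - of_real m * v))\<^sup>2" by simp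
  also have "\<dots> = d\<^sup>2 * (cmod w)\<^sup>2 - m * (2 * d * Re (cnj v * w)) + m\<^sup>2 * (cmod v)\<^sup>2"
    by (simp add: cmod_power2) (simp add: power2_eq_square algebra_simps)
  finally have "(2 * d * Re (cnj v * w) - m * (cmod v)\<^sup>2) * m \<le> (cmod w)\<^sup>2 * d\<^sup>2"
    by (simp add: algebra_simps power2_eq_square)
  then show ?thesis
    unfolding times_divide_eq_right by (rule mult_imp_le_div_pos[OF assms])
qed

lemma scalar_var_form_eq:
  fixes d m :: real and w :: complex
  assumes "0 < m"
  shows "2 * d * Re (cnj (of_real (d / m) * w) * w) - m * (cmod (of_real (d / m) * w))\<^sup>2
    = (cmod w)\<^sup>2 * (d\<^sup>2 / m)"
  using assms
  by (simp add: norm_mult power_mult_distrib cmod_power2)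
     (simp add: power2_eq_square field_simps)

text \<open>
  The squared norm of \<open>T - B\<close> with respect to the inverse of the positive operator
  \<open>V \<mapsto> (1 - s) B V + s V T\<close>, whose eigenvectors are built from the eigenbases of \<open>T\<close> and \<open>B\<close>.
\<close>

definition entropy_integrand :: "complex^'n^'n \<Rightarrow> ('n \<Rightarrow> real) \<Rightarrow> ('n \<Rightarrow> real) \<Rightarrow> real \<Rightarrow> real" where
  "entropy_integrand w t b s =
    (\<Sum>i\<in>UNIV. \<Sum>j\<in>UNIV. (cmod (w $ j $ i))\<^sup>2 * ((t i - b j)\<^sup>2 / ((1 - s) * b j + s * t i)))"

lemma rel_entropy_integral:
  fixes w :: "complex^'n^'n"
  assumes "\<And>i. 0 < t i" "\<And>j. 0 < b j"
  shows "((\<lambda>s. (1 - s) * entropy_integrand w t b s) has_integral rel_entropy w t b) {0..1}"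
proof -
  have "((\<lambda>s. \<Sum>i\<in>UNIV. \<Sum>j\<in>UNIV. (cmod (w $ j $ i))\<^sup>2 *
      ((1 - s) * ((t i - b j)\<^sup>2 / ((1 - s) * b j + s * t i)))) has_integral rel_entropy w t b) {0..1}"
    unfolding rel_entropy_def
    by (intro has_integral_sum has_integral_mult_right scalar_rel_entropy_integral assms) auto
  then show ?thesis
    by (simp add: entropy_integrand_def sum_distrib_left mult_ac)
qed

lemma var_form_le_entropy_integrand:
  fixes T B V :: "complex^'n^'n"
  assumes T: "diagonalizes E t T" and B: "diagonalizes F b B"
    and pos: "\<And>i. 0 < t i" "\<And>j. 0 < b j" and s: "s \<in> {0..1}"
  shows "var_form s V T B \<le> entropy_integrand (adj F ** E) t b s"
proof -
  have "E ** adj E = mat 1" "F ** adj F = mat 1"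
    using T B by (auto simp: diagonalizes_def intro: adj_mult_eq_one_commute)
  then have "F ** (adj F ** V ** E) ** adj E = V"
    by (metis matrix_mul_assoc matrix_mul_lid matrix_mul_rid)
  then have "var_form s V T B = var_form s (F ** (adj F ** V ** E) ** adj E) T B" by simp
  also have "\<dots> \<le> entropy_integrand (adj F ** E) t b s"
    unfolding var_form_diagonalizes[OF T B] entropy_integrand_def
    by (intro sum_mono scalar_var_form_le segment_pos pos s)
  finally show ?thesis .
qed

text \<open>
  The preimage of \<open>T - B\<close> under \<open>V \<mapsto> (1 - s) B V + s V T\<close>, at which the square in
  \<open>scalar_var_form_le\<close> vanishes for each pair of eigenvectors.
\<close>

definition optimal_direction :: "complex^'n^'n \<Rightarrow> ('n \<Rightarrow> real) \<Rightarrow> complex^'n^'n \<Rightarrow> ('n \<Rightarrow> real) \<Rightarrow> real \<Rightarrow> complex^'n^'n" where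
  "optimal_direction E t F b s = F **
    (\<chi> j i. of_real ((t i - b j) / ((1 - s) * b j + s * t i)) * (adj F ** E) $ j $ i) ** adj E"

lemma var_form_optimal_direction:
  fixes T B :: "complex^'n^'n"
  assumes T: "diagonalizes E t T" and B: "diagonalizes F b B"
    and pos: "\<And>i. 0 < t i" "\<And>j. 0 < b j" and s: "s \<in> {0..1}"
  shows "var_form s (optimal_direction E t F b s) T B = entropy_integrand (adj F ** E) t b s"
  unfolding optimal_direction_def var_form_diagonalizes[OF T B] entropy_integrand_def
  by (intro sum.cong refl) (simp only: vec_lambda_beta scalar_var_form_eq[OF segment_pos[OF pos s]])

lemma continuous_on_optimal_direction:
  assumes "\<And>i. 0 < t i" "\<And>j. 0 < b j"
  shows "continuous_on {0..1} (optimal_direction E t F b)"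
proof -
  have nz: "(1 - s) * b j + s * t i \<noteq> 0" if "s \<in> {0..1}" for s i j
    using segment_pos[OF assms that] by (metis less_irrefl)
  show ?thesis
    unfolding optimal_direction_def matrix_matrix_mult_def vec_lambda_beta
    by (intro continuous_intros ballI nz)
qed

lemma continuous_on_var_form:
  assumes V: "continuous_on S V"
  shows "continuous_on S (\<lambda>s. var_form s (V s) T B)"
  unfolding var_form_def trace_def matrix_matrix_mult_def vec_lambda_beta adj_nth
  by (intro continuous_intros V)

text \<open>
  Joint convexity of the relative entropy, in the form of a supporting hyperplane at each point.
  Every \<open>var_form\<close> is linear in the pair of matrices, hence so is the integral of the ones that are
  optimal at the base point. In this form Jensen's inequality for random matrices needs only the
  linearity of the expectation, and no measurable choice of eigenbases.
\<close>

theorem rel_entropy_supporting_functional: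
  fixes T\<^sub>0 B\<^sub>0 :: "complex^'n^'n"
  assumes T0: "diagonalizes E\<^sub>0 t\<^sub>0 T\<^sub>0" and B0: "diagonalizes F\<^sub>0 b\<^sub>0 B\<^sub>0"
    and pos0: "\<And>i. 0 < t\<^sub>0 i" "\<And>j. 0 < b\<^sub>0 j"
  obtains f g :: "complex^'n^'n \<Rightarrow> real" where "bounded_linear f" "bounded_linear g"
    "f T\<^sub>0 + g B\<^sub>0 = rel_entropy (adj F\<^sub>0 ** E\<^sub>0) t\<^sub>0 b\<^sub>0"
    "\<And>T B E t F b. \<lbrakk>diagonalizes E t T; diagonalizes F b B; \<And>i. 0 < t i; \<And>j. 0 < b j\<rbrakk>
      \<Longrightarrow> f T + g B \<le> rel_entropy (adj F ** E) t b"
proof -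
  define V where "V = optimal_direction E\<^sub>0 t\<^sub>0 F\<^sub>0 b\<^sub>0"
  define h where "h = (\<lambda>T B s. (1 - s) * var_form s (V s) T B)"
  define J where "J = (\<lambda>T B. integral {0..1} (h T B))"
  have int: "h T B integrable_on {0..1}" for T B
    unfolding h_def V_def
    by (intro integrable_continuous_real continuous_intros continuous_on_var_form
        continuous_on_optimal_direction pos0)
  have h_add: "h (T + T') (B + B') s = h T B s + h T' B' s" for T T' B B' s
    by (simp add: h_def var_form_def matrix_diff_ldistrib matrix_add_ldistrib matrix_add_rdistrib
        trace_add trace_sub algebra_simps)
  have scl: "A ** (r *\<^sub>R C) = r *\<^sub>R (A ** C)" "(r *\<^sub>R C) ** A = r *\<^sub>R (C ** A)"
    "Re (trace (r *\<^sub>R C)) = r * Re (trace C)" for A C :: "complex^'n^'n" and r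
    by (simp_all add: vec_eq_iff matrix_matrix_mult_def trace_def scaleR_sum_right sum_distrib_left)
  have h_scale: "h (r *\<^sub>R T) (r *\<^sub>R B) s = r * h T B s" for T B s r
    by (simp add: h_def var_form_def matrix_diff_ldistrib trace_sub scl algebra_simps)
  have J_add: "J (T + T') (B + B') = J T B + J T' B'" for T T' B B'
    unfolding J_def h_add by (intro integral_add int)
  have J_scale: "J (r *\<^sub>R T) (r *\<^sub>R B) = r * J T B" for T B r
    unfolding J_def h_scale by simp
  have "linear (\<lambda>T. J T 0)" "linear (\<lambda>B. J 0 B)"
    using J_add[of _ _ 0 0] J_add[of 0 0] J_scale[of _ _ 0] J_scale[of _ 0]
    by (auto intro!: linearI)
  then have lin: "bounded_linear (\<lambda>T. J T 0)" "bounded_linear (\<lambda>B. J 0 B)"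
    by (simp_all add: linear_conv_bounded_linear)
  have split: "J T 0 + J 0 B = J T B" for T B
    using J_add[of T 0 0 B] by simp
  have "J T\<^sub>0 B\<^sub>0 = integral {0..1} (\<lambda>s. (1 - s) * entropy_integrand (adj F\<^sub>0 ** E\<^sub>0) t\<^sub>0 b\<^sub>0 s)"
    unfolding J_def h_def V_def
    by (intro integral_cong) (simp add: var_form_optimal_direction[OF T0 B0 pos0])
  then have eq: "J T\<^sub>0 B\<^sub>0 = rel_entropy (adj F\<^sub>0 ** E\<^sub>0) t\<^sub>0 b\<^sub>0"
    using rel_entropy_integral[where t = t\<^sub>0 and b = b\<^sub>0, OF pos0] by (simp add: integral_unique)
  have le: "J T B \<le> rel_entropy (adj F ** E) t b"
    if "diagonalizes E t T" "diagonalizes F b B" "\<And>i. 0 < t i" "\<And>j. 0 < b j" for T B E t F b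
  proof (rule has_integral_le)
    show "(h T B has_integral J T B) {0..1}" unfolding J_def by (rule integrable_integral[OF int])
    show "((\<lambda>s. (1 - s) * entropy_integrand (adj F ** E) t b s) has_integral
        rel_entropy (adj F ** E) t b) {0..1}"
      by (rule rel_entropy_integral) (use that in auto)
    fix s :: real assume s: "s \<in> {0..1}"
    show "h T B s \<le> (1 - s) * entropy_integrand (adj F ** E) t b s"
      unfolding h_def
      by (intro mult_left_mono var_form_le_entropy_integrand that s) (use s in auto)
  qed
  show ?thesis
    by (rule that[OF lin]) (simp_all add: split eq le)
qed

section \<open>The matrix exponential and random matrices with bounded spectrum\<close>

primrec mat_power :: "complex^'n^'n \<Rightarrow> nat \<Rightarrow> complex^'n^'n" where
  "mat_power A 0 = mat 1"
| "mat_power A (Suc n) = A ** mat_power A n"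

text \<open>
  The exponential series is summed entry by entry, which makes the function Borel measurable on the
  space of all matrices.
\<close>

definition mexp :: "complex^'n^'n \<Rightarrow> complex^'n^'n" where
  "mexp A = (\<chi> i j. \<Sum>n. mat_power A n $ i $ j / fact n)"

definition tr_exp :: "complex^'n^'n \<Rightarrow> real" where
  "tr_exp A = Re (trace (mexp A))"

lemma conj_diag_nth:
  "(U ** diag l ** adj U) $ i $ j = (\<Sum>k\<in>UNIV. U $ i $ k * complex_of_real (l k) * cnj (U $ j $ k))"
  by (simp add: matrix_matrix_mult_def[of "U ** diag l"] mult_diag_nth)

lemma mat_power_diagonalizes:
  assumes "diagonalizes U l A"
  shows "mat_power A n = U ** diag (\<lambda>i. l i ^ n) ** adj U"
proof (induction n)
  case 0
  have "diag (\<lambda>i. l i ^ 0) = (mat 1 :: complex^'a^'a)" by (simp add: vec_eq_iff diag_def mat_def)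
  then show ?case using assms by (simp add: diagonalizes_def adj_mult_eq_one_commute)
next
  case (Suc n)
  have UU: "adj U ** U = mat 1" and A: "A = U ** diag l ** adj U"
    using assms by (auto simp: diagonalizes_def)
  have "mat_power A (Suc n) = U ** diag l ** (adj U ** U) ** diag (\<lambda>i. l i ^ n) ** adj U"
    by (simp only: mat_power.simps Suc.IH) (simp only: A matrix_mul_assoc)
  also have "\<dots> = U ** (diag l ** diag (\<lambda>i. l i ^ n)) ** adj U" by (simp add: UU matrix_mul_assoc)
  also have "diag l ** diag (\<lambda>i. l i ^ n) = diag (\<lambda>i. l i ^ Suc n)"
    by (simp add: vec_eq_iff mult_diag_nth) (simp add: diag_def)
  finally show ?case .
qed

lemma diagonalizes_mexp:
  assumes "diagonalizes U l A"
  shows "diagonalizes U (\<lambda>i. exp (l i)) (mexp A)"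
proof -
  have "mexp A $ i $ j = (U ** diag (\<lambda>i. exp (l i)) ** adj U) $ i $ j" for i j
  proof -
    have "(\<lambda>n. \<Sum>k\<in>UNIV. U $ i $ k * (complex_of_real (l k) ^ n /\<^sub>R fact n) * cnj (U $ j $ k)) sums
        (\<Sum>k\<in>UNIV. U $ i $ k * exp (complex_of_real (l k)) * cnj (U $ j $ k))"
      by (intro sums_sum sums_mult sums_mult2 exp_converges)
    also have "(\<lambda>n. \<Sum>k\<in>UNIV. U $ i $ k * (complex_of_real (l k) ^ n /\<^sub>R fact n) * cnj (U $ j $ k)) =
        (\<lambda>n. mat_power A n $ i $ j / fact n)"
      by (simp add: mat_power_diagonalizes[OF assms] conj_diag_nth sum_distrib_left scaleR_conv_of_real
          divide_inverse mult_ac)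
    finally show ?thesis
      by (simp add: mexp_def conj_diag_nth sums_iff exp_of_real)
  qed
  then show ?thesis using assms by (simp add: diagonalizes_def vec_eq_iff)
qed

lemma tr_exp_diagonalizes: "diagonalizes U l A \<Longrightarrow> tr_exp A = (\<Sum>i\<in>UNIV. exp (l i))"
  unfolding tr_exp_def by (rule trace_diagonalizes[OF diagonalizes_mexp])

lemma borel_measurable_vecI:
  fixes f :: "'a \<Rightarrow> 'b::euclidean_space^'n"
  assumes "\<And>i. (\<lambda>x. f x $ i) \<in> borel_measurable M"
  shows "f \<in> borel_measurable M"
  unfolding borel_measurable_euclidean_space[of f]
  using assms by (auto simp: Basis_vec_def inner_axis intro!: borel_measurable_inner)

lemma continuous_on_mat_power: "continuous_on UNIV (\<lambda>A. mat_power A n)"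
proof (induction n)
  case (Suc n)
  then show ?case
    unfolding mat_power.simps matrix_matrix_mult_def by (intro continuous_intros)
qed simp

lemma borel_measurable_mexp [measurable]: "mexp \<in> borel_measurable borel"
proof (intro borel_measurable_vecI)
  fix i j
  have "(\<lambda>A. mat_power A n $ i $ j / fact n) \<in> borel_measurable borel" for n
    by (intro borel_measurable_continuous_onI continuous_intros continuous_on_mat_power) auto
  then have "(\<lambda>A. \<Sum>n. mat_power A n $ i $ j / fact n) \<in> borel_measurable borel"
    by (rule borel_measurable_suminf)
  then show "(\<lambda>A. mexp A $ i $ j) \<in> borel_measurable borel"
    by (simp add: mexp_def)
qed

lemma linear_Re_trace: "linear (\<lambda>A::complex^'n^'n. Re (trace A))"
  by (rule linearI) (simp_all add: trace_def sum.distrib sum_distrib_left)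

lemma bounded_linear_Re_trace: "bounded_linear (\<lambda>A::complex^'n^'n. Re (trace A))"
  using linear_Re_trace by (simp add: linear_conv_bounded_linear)

lemma linear_matrix_mult: "linear (\<lambda>A::complex^'n^'n. U ** A ** V)"
  by (rule linearI)
     (simp_all add: vec_eq_iff matrix_matrix_mult_def sum.distrib distrib_left distrib_right
       flip: scaleR_sum_right)

lemma borel_measurable_tr_exp [measurable]: "tr_exp \<in> borel_measurable borel"
proof -
  have [measurable]: "(\<lambda>A::complex^'n^'n. Re (trace A)) \<in> borel_measurable borel"
    by (intro borel_measurable_continuous_onI linear_continuous_on bounded_linear_Re_trace)
  show ?thesis unfolding tr_exp_def by measurable
qed

definition spectrum_in :: "real \<Rightarrow> real \<Rightarrow> complex^'n^'n \<Rightarrow> bool" where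
  "spectrum_in a b A \<longleftrightarrow> hermitian A \<and> a \<le> lambda_min A \<and> lambda_max A \<le> b"

lemma spectrum_in_diagonalizes:
  fixes A :: "complex^'n^'n"
  assumes "diagonalizes U l A"
  shows "spectrum_in a b A \<longleftrightarrow> (\<forall>i. a \<le> l i \<and> l i \<le> b)"
  using diagonalizes_hermitian[OF assms]
  by (auto simp: spectrum_in_def lambda_min_diagonalizes[OF assms] lambda_max_diagonalizes[OF assms])

lemma norm_le_spectrum:
  fixes A :: "complex^'n^'n"
  assumes "spectrum_in a b A"
  shows "norm A \<le> real CARD('n) * max \<bar>a\<bar> \<bar>b\<bar>"
proof -
  obtain U l where A: "diagonalizes U l A"
    using spectral_theorem assms by (auto simp: spectrum_in_def)
  have "norm A \<le> (\<Sum>i\<in>UNIV. \<bar>l i\<bar>)" by (rule norm_le_sum_abs_eigenvalues[OF A])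
  also have "\<dots> \<le> (\<Sum>i\<in>(UNIV::'n set). max \<bar>a\<bar> \<bar>b\<bar>)"
    using assms unfolding spectrum_in_diagonalizes[OF A] by (intro sum_mono) (smt (verit))
  finally show ?thesis by simp
qed

lemma spectrum_in_mexp:
  assumes "hermitian A" "norm A \<le> K"
  shows "spectrum_in (exp (- K)) (exp K) (mexp A)"
proof -
  obtain U l where A: "diagonalizes U l A" using spectral_theorem assms by auto
  have "- K \<le> l i \<and> l i \<le> K" for i using abs_eigenvalue_le_norm[OF A, of i] assms(2) by linarith
  then show ?thesis by (simp add: spectrum_in_diagonalizes[OF diagonalizes_mexp[OF A]])
qed

lemma linear_adj: "linear (adj :: complex^'n^'n \<Rightarrow> complex^'n^'n)"
  by (rule linearI) (simp_all add: vec_eq_iff)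

lemma hermitian_add: "hermitian A \<Longrightarrow> hermitian B \<Longrightarrow> hermitian (A + B)"
  by (simp add: hermitian_iff_adj linear_add[OF linear_adj])

lemma hermitian_scaleR: "hermitian A \<Longrightarrow> hermitian (r *\<^sub>R A)"
  by (simp add: hermitian_iff_adj linear_scale[OF linear_adj])

lemma hermitian_sum: "(\<And>k. k \<in> I \<Longrightarrow> hermitian (A k)) \<Longrightarrow> hermitian (\<Sum>k\<in>I. A k)"
  by (simp add: hermitian_iff_adj linear_sum[OF linear_adj])

lemma (in prob_space) integrable_spectrum_in:
  fixes A :: "'a \<Rightarrow> complex^'n^'n"
  assumes "A \<in> borel_measurable M" "AE \<omega> in M. spectrum_in a b (A \<omega>)"
  shows "integrable M A"
proof (rule integrable_const_bound)
  show "AE \<omega> in M. norm (A \<omega>) \<le> real CARD('n) * max \<bar>a\<bar> \<bar>b\<bar>"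
    using assms(2) by eventually_elim (rule norm_le_spectrum)
qed (rule assms)

text \<open>
  An eigenvalue of the mean is a diagonal entry of the mean in its own eigenbasis, hence the mean of
  the corresponding diagonal entries, all of which lie between the bounds.
\<close>

lemma (in prob_space) spectrum_in_expectation:
  fixes A :: "'a \<Rightarrow> complex^'n^'n"
  assumes int: "integrable M A" and A: "AE \<omega> in M. spectrum_in a b (A \<omega>)"
  shows "spectrum_in a b (\<integral>\<omega>. A \<omega> \<partial>M)"
proof -
  have "adj (\<integral>\<omega>. A \<omega> \<partial>M) = (\<integral>\<omega>. adj (A \<omega>) \<partial>M)"
    using linear_adj int by (intro integral_bounded_linear[symmetric]) (simp_all add: linear_conv_bounded_linear)
  also have "\<dots> = (\<integral>\<omega>. A \<omega> \<partial>M)"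
  proof (rule integral_cong_AE)
    show "(\<lambda>\<omega>. adj (A \<omega>)) \<in> borel_measurable M"
      using linear_adj int
      by (intro borel_measurable_integrable integrable_bounded_linear[of adj]) (simp_all add: linear_conv_bounded_linear)
    show "AE \<omega> in M. adj (A \<omega>) = A \<omega>"
      using A by eventually_elim (simp add: spectrum_in_def hermitian_iff_adj)
  qed (use int in auto)
  finally obtain U l where U: "diagonalizes U l (\<integral>\<omega>. A \<omega> \<partial>M)"
    using spectral_theorem hermitian_iff_adj by blast
  have UU: "adj U ** U = mat 1" using U by (simp add: diagonalizes_def)
  have "a \<le> l k \<and> l k \<le> b" for k
  proof -
    define q where "q = (\<lambda>B. Re ((adj U ** B ** U) $ k $ k))"
    have "linear q"
      unfolding q_def
      by (rule linearI)
         (simp_all add: linear_add[OF linear_matrix_mult] linear_scale[OF linear_matrix_mult])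
    then have q: "bounded_linear q" by (simp add: linear_conv_bounded_linear)
    have "l k = q (\<integral>\<omega>. A \<omega> \<partial>M)"
      by (simp add: q_def diagonalizes_conj[OF U]) (simp add: diag_def)
    also have "\<dots> = (\<integral>\<omega>. q (A \<omega>) \<partial>M)"
      by (rule integral_bounded_linear[OF q int, symmetric])
    finally have lk: "l k = (\<integral>\<omega>. q (A \<omega>) \<partial>M)" .
    have bounds: "AE \<omega> in M. a \<le> q (A \<omega>) \<and> q (A \<omega>) \<le> b"
      using A
    proof eventually_elim
      case (elim \<omega>)
      then obtain E t where E: "diagonalizes E t (A \<omega>)"
        using spectral_theorem by (auto simp: spectrum_in_def)
      show ?case
        unfolding q_def using elim diagonal_entry_between[OF E UU, of a b k]
        unfolding spectrum_in_diagonalizes[OF E] by blast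
    qed
    have qi: "integrable M (\<lambda>\<omega>. q (A \<omega>))" by (rule integrable_bounded_linear[OF q int])
    have "a = (\<integral>\<omega>. a \<partial>M)" "b = (\<integral>\<omega>. b \<partial>M)" by (simp_all add: prob_space)
    moreover have "(\<integral>\<omega>. a \<partial>M) \<le> (\<integral>\<omega>. q (A \<omega>) \<partial>M)"
      by (intro integral_mono_AE qi integrable_const) (use bounds in auto)
    moreover have "(\<integral>\<omega>. q (A \<omega>) \<partial>M) \<le> (\<integral>\<omega>. b \<partial>M)"
      by (intro integral_mono_AE qi integrable_const) (use bounds in auto)
    ultimately show ?thesis using lk by linarith
  qed
  then show ?thesis by (simp add: spectrum_in_diagonalizes[OF U])
qed

section \<open>Averaging one summand\<close>

lemma diagonalizes_one_plus:
  assumes "diagonalizes U l A"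
  shows "diagonalizes U (\<lambda>i. 1 + c * l i) (mat 1 + c *\<^sub>R A)"
proof -
  have UU: "adj U ** U = mat 1" and A: "A = U ** diag l ** adj U"
    using assms by (auto simp: diagonalizes_def)
  have "diag (\<lambda>i. 1 + c * l i) = mat 1 + c *\<^sub>R diag l"
    by (simp add: vec_eq_iff diag_def mat_def scaleR_conv_of_real[where 'a=complex])
  then have "U ** diag (\<lambda>i. 1 + c * l i) ** adj U = U ** mat 1 ** adj U + c *\<^sub>R (U ** diag l ** adj U)"
    by (simp only: linear_add[OF linear_matrix_mult] linear_scale[OF linear_matrix_mult])
  then show ?thesis using UU A by (simp add: diagonalizes_def adj_mult_eq_one_commute)
qed

text \<open>
  The row and column sums of the weights are 1, so only the mixed terms keep them.
\<close>

lemma sum_unitary_weights: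
  fixes w :: "complex^'n^'n"
  assumes "adj w ** w = mat 1"
  shows "(\<Sum>i\<in>UNIV. \<Sum>j\<in>UNIV. (cmod (w $ j $ i))\<^sup>2 * (t i * (\<alpha> i - \<beta> j) - t i + b j)) =
    (\<Sum>i\<in>UNIV. t i * \<alpha> i) - (\<Sum>i\<in>UNIV. \<Sum>j\<in>UNIV. (cmod (w $ j $ i))\<^sup>2 * (t i * \<beta> j))
    - (\<Sum>i\<in>UNIV. t i) + (\<Sum>j\<in>UNIV. b j)"
proof -
  have 1: "(\<Sum>i\<in>UNIV. \<Sum>j\<in>UNIV. (cmod (w $ j $ i))\<^sup>2 * u i) = (\<Sum>i\<in>UNIV. u i)" for u
    using unitary_column_sum[OF assms] by (simp flip: sum_distrib_right)
  have 2: "(\<Sum>i\<in>UNIV. \<Sum>j\<in>UNIV. (cmod (w $ j $ i))\<^sup>2 * u j) = (\<Sum>i\<in>UNIV. u i)" for u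
    by (subst sum.swap) (use unitary_row_sum[OF assms] in \<open>simp flip: sum_distrib_right\<close>)
  have "(\<Sum>i\<in>UNIV. \<Sum>j\<in>UNIV. (cmod (w $ j $ i))\<^sup>2 * (t i * (\<alpha> i - \<beta> j) - t i + b j)) =
    (\<Sum>i\<in>UNIV. \<Sum>j\<in>UNIV. (cmod (w $ j $ i))\<^sup>2 * (t i * \<alpha> i))
    - (\<Sum>i\<in>UNIV. \<Sum>j\<in>UNIV. (cmod (w $ j $ i))\<^sup>2 * (t i * \<beta> j))
    - (\<Sum>i\<in>UNIV. \<Sum>j\<in>UNIV. (cmod (w $ j $ i))\<^sup>2 * t i)
    + (\<Sum>i\<in>UNIV. \<Sum>j\<in>UNIV. (cmod (w $ j $ i))\<^sup>2 * b j)"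
    unfolding sum_subtractf[symmetric] sum.distrib[symmetric]
    by (intro sum.cong refl) (simp add: algebra_simps)
  then show ?thesis by (simp only: 1 2)
qed

lemma trace_mult_same_basis:
  fixes T G :: "complex^'n^'n"
  assumes T: "diagonalizes E t T" and G: "diagonalizes E \<gamma> G"
  shows "Re (trace (T ** G)) = (\<Sum>i\<in>UNIV. t i * \<gamma> i)"
proof -
  have EE: "adj E ** E = mat 1" using T by (simp add: diagonalizes_def)
  have "(cmod ((adj E ** E) $ j $ i))\<^sup>2 * u = (if j = i then u else 0)" for i j u
    by (simp add: EE mat_def)
  then show ?thesis
    by (simp add: trace_mult_diagonalizes[OF T G] del: diagonalizes_def)
qed

lemma trace_mult_add_scaleR:
  "Re (trace (T ** (H + r *\<^sub>R X))) = Re (trace (T ** H)) + r * Re (trace (T ** X))"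
  for T :: "complex^'n^'n"
  by (simp add: trace_def matrix_matrix_mult_def distrib_left sum.distrib sum_distrib_left mult_ac)

text \<open>
  As \<open>T = exp (H + \<theta> X)\<close> has the logarithm \<open>H + \<theta> X\<close> and \<open>ln B\<close> dominates \<open>\<theta> X\<close> in the eigenbasis of \<open>X\<close>,
  the nonlinear terms \<open>Tr (T ln T) - Tr (T ln B)\<close> are at most \<open>Tr (T (H + \<theta> X)) - \<theta> Tr (T X) = Tr (T H)\<close>.
\<close>

lemma rel_entropy_exponential_le:
  fixes H X :: "complex^'n^'n"
  assumes H: "hermitian H" and X: "diagonalizes F x X"
    and G: "diagonalizes E \<gamma> (H + \<theta> *\<^sub>R X)"
    and bound: "\<And>j. exp (\<theta> * x j) \<le> b j" and B: "diagonalizes F b B"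
  shows "rel_entropy (adj F ** E) (\<lambda>i. exp (\<gamma> i)) b \<le>
    Re (trace (mexp (H + \<theta> *\<^sub>R X) ** H)) - tr_exp (H + \<theta> *\<^sub>R X) + Re (trace B)"
proof -
  define T where "T = mexp (H + \<theta> *\<^sub>R X)"
  define w where "w = adj F ** E"
  have T: "diagonalizes E (\<lambda>i. exp (\<gamma> i)) T" unfolding T_def by (rule diagonalizes_mexp[OF G])
  have w: "adj w ** w = mat 1"
    unfolding w_def using X G by (intro adj_mult_unitary) (simp_all add: diagonalizes_def)
  have "rel_entropy w (\<lambda>i. exp (\<gamma> i)) b \<le> (\<Sum>i\<in>UNIV. \<Sum>j\<in>UNIV. (cmod (w $ j $ i))\<^sup>2 *
      (exp (\<gamma> i) * (\<gamma> i - \<theta> * x j) - exp (\<gamma> i) + b j))"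
    unfolding rel_entropy_def
  proof (intro sum_mono mult_left_mono zero_le_power2)
    fix i j
    have "\<theta> * x j \<le> ln (b j)"
      using bound[of j] by (metis exp_gt_zero less_le_trans ln_ge_iff)
    then have "exp (\<gamma> i) * (\<gamma> i - ln (b j)) \<le> exp (\<gamma> i) * (\<gamma> i - \<theta> * x j)"
      by (intro mult_left_mono) auto
    then show "exp (\<gamma> i) * (ln (exp (\<gamma> i)) - ln (b j)) - exp (\<gamma> i) + b j
        \<le> exp (\<gamma> i) * (\<gamma> i - \<theta> * x j) - exp (\<gamma> i) + b j" by simp
  qed
  also have "\<dots> = Re (trace (T ** (H + \<theta> *\<^sub>R X))) - \<theta> * Re (trace (T ** X)) - Re (trace T) + Re (trace B)"
    unfolding sum_unitary_weights[OF w] trace_mult_same_basis[OF T G] trace_mult_diagonalizes[OF T X]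
      trace_diagonalizes[OF T] trace_diagonalizes[OF B]
    by (simp add: w_def sum_distrib_left mult_ac)
  finally show ?thesis by (simp add: trace_mult_add_scaleR T_def tr_exp_def w_def)
qed

text \<open>
  This uses \<open>ln (1 + u) \<le> u\<close> at the eigenvalues \<open>u\<close> of \<open>c Q\<close>.
\<close>

lemma rel_entropy_affine_ge:
  fixes T Q :: "complex^'n^'n"
  assumes T: "diagonalizes E t T" and Q: "diagonalizes F q Q"
    and pos: "\<And>i. 0 < t i" "\<And>j. 0 < 1 + c * q j"
  shows "(\<Sum>i\<in>UNIV. t i * ln (t i)) - c * Re (trace (T ** Q)) - Re (trace T)
    + Re (trace (mat 1 + c *\<^sub>R Q)) \<le> rel_entropy (adj F ** E) t (\<lambda>j. 1 + c * q j)"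
proof -
  define w where "w = adj F ** E"
  have w: "adj w ** w = mat 1"
    unfolding w_def using T Q by (intro adj_mult_unitary) (simp_all add: diagonalizes_def)
  have "(\<Sum>i\<in>UNIV. t i * ln (t i)) - c * Re (trace (T ** Q)) - Re (trace T)
    + Re (trace (mat 1 + c *\<^sub>R Q)) = (\<Sum>i\<in>UNIV. \<Sum>j\<in>UNIV. (cmod (w $ j $ i))\<^sup>2 *
      (t i * (ln (t i) - c * q j) - t i + (1 + c * q j)))"
    unfolding sum_unitary_weights[OF w] trace_mult_diagonalizes[OF T Q]
      trace_diagonalizes[OF T] trace_diagonalizes[OF diagonalizes_one_plus[OF Q]]
    by (simp add: w_def sum_distrib_left mult_ac)
  also have "\<dots> \<le> rel_entropy w t (\<lambda>j. 1 + c * q j)"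
    unfolding rel_entropy_def
  proof (intro sum_mono mult_left_mono zero_le_power2 add_right_mono diff_right_mono)
    fix i j
    have "ln (1 + c * q j) \<le> c * q j" using ln_le_minus_one[OF pos(2)[of j]] by simp
    then show "ln (t i) - c * q j \<le> ln (t i) - ln (1 + c * q j)" by simp
    show "0 \<le> t i" using pos(1)[of i] by simp
  qed
  finally show ?thesis by (simp add: w_def)
qed

text \<open>
  Nonnegativity of the relative entropy of \<open>T\<close> with respect to \<open>exp G\<close> (Klein's inequality).
\<close>

lemma gibbs_variational:
  fixes T G :: "complex^'n^'n"
  assumes T: "diagonalizes E t T" and pos: "\<And>i. 0 < t i" and G: "hermitian G"
  shows "Re (trace (T ** G)) - (\<Sum>i\<in>UNIV. t i * ln (t i)) + Re (trace T) \<le> tr_exp G"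
proof -
  obtain F \<gamma> where F: "diagonalizes F \<gamma> G" using spectral_theorem[OF G] by blast
  define w where "w = adj F ** E"
  have w: "adj w ** w = mat 1"
    unfolding w_def using T F by (intro adj_mult_unitary) (simp_all add: diagonalizes_def)
  have "0 \<le> (\<Sum>i\<in>UNIV. \<Sum>j\<in>UNIV. (cmod (w $ j $ i))\<^sup>2 *
      (t i * (ln (t i) - ln (exp (\<gamma> j))) - t i + exp (\<gamma> j)))"
    by (intro sum_nonneg mult_nonneg_nonneg zero_le_power2 scalar_rel_entropy_nonneg pos exp_gt_zero)
  also have "\<dots> = (\<Sum>i\<in>UNIV. \<Sum>j\<in>UNIV. (cmod (w $ j $ i))\<^sup>2 *
      (t i * (ln (t i) - \<gamma> j) - t i + exp (\<gamma> j)))" by simp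
  also have "\<dots> = (\<Sum>i\<in>UNIV. t i * ln (t i)) - Re (trace (T ** G)) - Re (trace T) + tr_exp G"
    unfolding sum_unitary_weights[OF w] trace_mult_diagonalizes[OF T F] trace_diagonalizes[OF T]
      tr_exp_diagonalizes[OF F] by (simp add: w_def)
  finally show ?thesis by simp
qed

text \<open>
  The consequence of Lieb's theorem that allows a single random summand to be averaged inside the
  trace exponential. The relative entropy of \<open>T = exp (H + \<theta> X)\<close> with respect to \<open>B = 1 + c X\<close> is bounded
  by a linear expression; the functional that supports the relative entropy at the means carries this
  bound over to the relative entropy of \<open>E T\<close> with respect to \<open>1 + c E X\<close>, and the variational
  principle concludes.
\<close>

theorem (in prob_space) tr_exp_expectation_le:
  fixes X :: "'a \<Rightarrow> complex^'n^'n"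
  assumes H: "hermitian H" and Xm: "X \<in> borel_measurable M"
    and X: "AE \<omega> in M. spectrum_in 0 L (X \<omega>)"
    and chord: "\<And>x. 0 \<le> x \<Longrightarrow> x \<le> L \<Longrightarrow> exp (\<theta> * x) \<le> 1 + c * x"
  shows "integrable M (\<lambda>\<omega>. tr_exp (H + \<theta> *\<^sub>R X \<omega>))"
    and "(\<integral>\<omega>. tr_exp (H + \<theta> *\<^sub>R X \<omega>) \<partial>M) \<le> tr_exp (H + c *\<^sub>R (\<integral>\<omega>. X \<omega> \<partial>M))"
proof -
  define T where "T = (\<lambda>\<omega>. mexp (H + \<theta> *\<^sub>R X \<omega>))"
  \<comment> \<open>\<open>K\<close> bounds the exponent; then \<open>T\<close> is integrable and its mean is positive definite.\<close>
  define K where "K = norm H + \<bar>\<theta>\<bar> * (real CARD('n) * \<bar>L\<bar>)"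
  define T\<^sub>0 Q where "T\<^sub>0 = (\<integral>\<omega>. T \<omega> \<partial>M)" and "Q = (\<integral>\<omega>. X \<omega> \<partial>M)"
  have Tm: "T \<in> borel_measurable M" unfolding T_def using Xm by measurable
  have T: "AE \<omega> in M. spectrum_in (exp (- K)) (exp K) (T \<omega>)"
    using X
  proof eventually_elim
    case (elim \<omega>)
    have "norm (H + \<theta> *\<^sub>R X \<omega>) \<le> norm H + \<bar>\<theta>\<bar> * norm (X \<omega>)"
      by (metis norm_scaleR norm_triangle_ineq)
    also have "\<dots> \<le> K"
      unfolding K_def using norm_le_spectrum[OF elim] by (intro add_left_mono mult_left_mono) auto
    finally show ?case
      unfolding T_def using elim H
      by (intro spectrum_in_mexp hermitian_add hermitian_scaleR) (auto simp: spectrum_in_def)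
  qed
  have Ti: "integrable M T" and Xi: "integrable M X"
    using integrable_spectrum_in[OF Tm T] integrable_spectrum_in[OF Xm X] .
  have T0: "spectrum_in (exp (- K)) (exp K) T\<^sub>0" and Q0: "spectrum_in 0 L Q"
    unfolding T\<^sub>0_def Q_def by (rule spectrum_in_expectation[OF Ti T], rule spectrum_in_expectation[OF Xi X])
  obtain E\<^sub>0 t\<^sub>0 where E0: "diagonalizes E\<^sub>0 t\<^sub>0 T\<^sub>0"
    using T0 spectral_theorem by (auto simp: spectrum_in_def)
  obtain F\<^sub>0 q where F0: "diagonalizes F\<^sub>0 q Q"
    using Q0 spectral_theorem by (auto simp: spectrum_in_def)
  have t0: "0 < t\<^sub>0 i" for i
    using T0 unfolding spectrum_in_diagonalizes[OF E0] by (meson exp_gt_zero less_le_trans)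
  have chord_pos: "0 < 1 + c * x" if "0 \<le> x" "x \<le> L" for x
    using chord[OF that] exp_gt_zero[of "\<theta> * x"] by linarith
  have q: "0 < 1 + c * q j" for j
    using Q0 unfolding spectrum_in_diagonalizes[OF F0] by (intro chord_pos) auto
  note B0 = diagonalizes_one_plus[OF F0, of c]
  obtain f g where f: "bounded_linear f" and g: "bounded_linear g"
    and eq: "f T\<^sub>0 + g (mat 1 + c *\<^sub>R Q) = rel_entropy (adj F\<^sub>0 ** E\<^sub>0) t\<^sub>0 (\<lambda>j. 1 + c * q j)"
    and le: "\<And>T B E t F b. \<lbrakk>diagonalizes E t T; diagonalizes F b B; \<And>i. 0 < t i; \<And>j. 0 < b j\<rbrakk>
      \<Longrightarrow> f T + g B \<le> rel_entropy (adj F ** E) t b"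
    using rel_entropy_supporting_functional[OF E0 B0 t0 q] by blast
  define B where "B = (\<lambda>\<omega>. mat 1 + c *\<^sub>R X \<omega>)"
  have Bi: "integrable M B" unfolding B_def using Xi by simp
  have EB: "(\<integral>\<omega>. B \<omega> \<partial>M) = mat 1 + c *\<^sub>R Q" unfolding B_def Q_def using Xi by (simp add: prob_space)
  have TH: "bounded_linear (\<lambda>A. Re (trace (A ** H)))"
    using linear_compose[OF linear_matrix_mult[of "mat 1" H] linear_Re_trace]
    by (simp add: linear_conv_bounded_linear o_def)
  note tr = bounded_linear_Re_trace
  have pointwise: "AE \<omega> in M. f (T \<omega>) + g (B \<omega>) \<le>
      Re (trace (T \<omega> ** H)) - Re (trace (T \<omega>)) + Re (trace (B \<omega>))"
    using X
  proof eventually_elim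
    case (elim \<omega>)
    then have herm: "hermitian (X \<omega>)" by (simp add: spectrum_in_def)
    obtain F x where F: "diagonalizes F x (X \<omega>)" using spectral_theorem[OF herm] by blast
    obtain E \<gamma> where E: "diagonalizes E \<gamma> (H + \<theta> *\<^sub>R X \<omega>)"
      using spectral_theorem[OF hermitian_add[OF H hermitian_scaleR[OF herm]]] by blast
    have x: "0 \<le> x j" "x j \<le> L" for j
      using elim unfolding spectrum_in_diagonalizes[OF F] by auto
    have "f (T \<omega>) + g (B \<omega>) \<le> rel_entropy (adj F ** E) (\<lambda>i. exp (\<gamma> i)) (\<lambda>j. 1 + c * x j)"
      unfolding T_def B_def
      by (intro le diagonalizes_mexp[OF E] diagonalizes_one_plus[OF F] exp_gt_zero chord_pos x)
    also have "\<dots> \<le> Re (trace (T \<omega> ** H)) - Re (trace (T \<omega>)) + Re (trace (B \<omega>))"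
      using rel_entropy_exponential_le[OF H F E chord[OF x] diagonalizes_one_plus[OF F]]
      by (simp add: T_def B_def tr_exp_def)
    finally show ?case .
  qed
  have "f T\<^sub>0 + g (mat 1 + c *\<^sub>R Q) = (\<integral>\<omega>. f (T \<omega>) + g (B \<omega>) \<partial>M)"
    using Ti Bi f g
    by (simp add: T\<^sub>0_def EB[symmetric] integral_bounded_linear integrable_bounded_linear)
  also have "\<dots> \<le> (\<integral>\<omega>. Re (trace (T \<omega> ** H)) - Re (trace (T \<omega>)) + Re (trace (B \<omega>)) \<partial>M)"
    by (rule integral_mono_AE[OF _ _ pointwise])
       (intro Bochner_Integration.integrable_add Bochner_Integration.integrable_diff
         integrable_bounded_linear[OF f Ti] integrable_bounded_linear[OF g Bi]
         integrable_bounded_linear[OF TH Ti] integrable_bounded_linear[OF tr Ti]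
         integrable_bounded_linear[OF tr Bi])+
  also have "\<dots> = Re (trace (T\<^sub>0 ** H)) - Re (trace T\<^sub>0) + Re (trace (mat 1 + c *\<^sub>R Q))"
    unfolding T\<^sub>0_def EB[symmetric] integral_bounded_linear[OF TH Ti, symmetric]
      integral_bounded_linear[OF tr Ti, symmetric] integral_bounded_linear[OF tr Bi, symmetric]
    by (simp add: integrable_bounded_linear[OF TH Ti] integrable_bounded_linear[OF tr Ti]
        integrable_bounded_linear[OF tr Bi])
  finally have "(\<Sum>i\<in>UNIV. t\<^sub>0 i * ln (t\<^sub>0 i)) \<le> Re (trace (T\<^sub>0 ** (H + c *\<^sub>R Q)))"
    using rel_entropy_affine_ge[OF E0 F0 t0 q] by (simp add: eq trace_mult_add_scaleR)
  moreover have "hermitian (H + c *\<^sub>R Q)"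
    using H Q0 by (intro hermitian_add hermitian_scaleR) (auto simp: spectrum_in_def)
  ultimately have "Re (trace T\<^sub>0) \<le> tr_exp (H + c *\<^sub>R Q)"
    using gibbs_variational[OF E0 t0, of "H + c *\<^sub>R Q"] by linarith
  moreover have "Re (trace T\<^sub>0) = (\<integral>\<omega>. tr_exp (H + \<theta> *\<^sub>R X \<omega>) \<partial>M)"
    unfolding T\<^sub>0_def integral_bounded_linear[OF tr Ti, symmetric] by (simp add: T_def tr_exp_def)
  ultimately show "(\<integral>\<omega>. tr_exp (H + \<theta> *\<^sub>R X \<omega>) \<partial>M) \<le> tr_exp (H + c *\<^sub>R (\<integral>\<omega>. X \<omega> \<partial>M))"
    by (simp add: Q_def)
  show "integrable M (\<lambda>\<omega>. tr_exp (H + \<theta> *\<^sub>R X \<omega>))"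
    using integrable_bounded_linear[OF tr Ti] by (simp add: T_def tr_exp_def)
qed

section \<open>Sums of independent random matrices\<close>

text \<open>
  Independence in the form of Tonelli's theorem.
\<close>

lemma (in prob_space) nn_integral_indep_var:
  assumes ind: "indep_var N\<^sub>1 X N\<^sub>2 Y" and f: "f \<in> borel_measurable (N\<^sub>1 \<Otimes>\<^sub>M N\<^sub>2)"
  shows "(\<integral>\<^sup>+\<omega>. f (X \<omega>, Y \<omega>) \<partial>M) = (\<integral>\<^sup>+\<omega>'. \<integral>\<^sup>+\<omega>. f (X \<omega>, Y \<omega>') \<partial>M \<partial>M)"
proof -
  have X: "random_variable N\<^sub>1 X" and Y: "random_variable N\<^sub>2 Y"
    and joint: "distr M N\<^sub>1 X \<Otimes>\<^sub>M distr M N\<^sub>2 Y = distr M (N\<^sub>1 \<Otimes>\<^sub>M N\<^sub>2) (\<lambda>\<omega>. (X \<omega>, Y \<omega>))"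
    using ind by (auto simp: indep_var_distribution_eq)
  interpret X: prob_space "distr M N\<^sub>1 X" by (rule prob_space_distr[OF X])
  interpret Y: prob_space "distr M N\<^sub>2 Y" by (rule prob_space_distr[OF Y])
  interpret P: pair_sigma_finite "distr M N\<^sub>1 X" "distr M N\<^sub>2 Y" ..
  have f': "f \<in> borel_measurable (distr M N\<^sub>1 X \<Otimes>\<^sub>M distr M N\<^sub>2 Y)"
    using f by (simp cong: measurable_cong_sets)
  have "(\<lambda>(y, x). f (x, y)) \<in> borel_measurable (N\<^sub>2 \<Otimes>\<^sub>M N\<^sub>1)"
    using f by measurable
  then have "(\<lambda>(y, x). f (x, y)) \<in> borel_measurable (N\<^sub>2 \<Otimes>\<^sub>M distr M N\<^sub>1 X)"
    by (simp cong: measurable_cong_sets)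
  then have inner: "(\<lambda>y. \<integral>\<^sup>+x. f (x, y) \<partial>distr M N\<^sub>1 X) \<in> borel_measurable N\<^sub>2"
    by (rule X.borel_measurable_nn_integral)
  have "(\<integral>\<^sup>+\<omega>. f (X \<omega>, Y \<omega>) \<partial>M) = integral\<^sup>N (distr M (N\<^sub>1 \<Otimes>\<^sub>M N\<^sub>2) (\<lambda>\<omega>. (X \<omega>, Y \<omega>))) f"
    by (rule nn_integral_distr[symmetric]) (use X Y f in auto)
  also have "\<dots> = (\<integral>\<^sup>+y. \<integral>\<^sup>+x. f (x, y) \<partial>distr M N\<^sub>1 X \<partial>distr M N\<^sub>2 Y)"
    unfolding joint[symmetric] by (rule P.nn_integral_snd[symmetric]) (rule f')
  also have "\<dots> = (\<integral>\<^sup>+\<omega>'. \<integral>\<^sup>+x. f (x, Y \<omega>') \<partial>distr M N\<^sub>1 X \<partial>M)"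
    by (rule nn_integral_distr[OF Y]) (simp add: inner)
  also have "\<dots> = (\<integral>\<^sup>+\<omega>'. \<integral>\<^sup>+\<omega>. f (X \<omega>, Y \<omega>') \<partial>M \<partial>M)"
  proof (rule nn_integral_cong)
    fix \<omega>' assume "\<omega>' \<in> space M"
    then have "Y \<omega>' \<in> space N\<^sub>2" by (rule measurable_space[OF Y])
    then have "(\<lambda>x. f (x, Y \<omega>')) \<in> borel_measurable N\<^sub>1" using f by measurable
    then show "(\<integral>\<^sup>+x. f (x, Y \<omega>') \<partial>distr M N\<^sub>1 X) = (\<integral>\<^sup>+\<omega>. f (X \<omega>, Y \<omega>') \<partial>M)"
      by (simp add: nn_integral_distr[OF X])
  qed
  finally show ?thesis .
qed

lemma (in prob_space) indep_vars_sum_euclidean: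
  fixes X :: "'i \<Rightarrow> 'a \<Rightarrow> 'b::euclidean_space"
  assumes I: "finite I" "i \<notin> I" and indep: "indep_vars (\<lambda>_. borel) X (insert i I)"
  shows "indep_var borel (X i) borel (\<lambda>\<omega>. \<Sum>i\<in>I. X i \<omega>)"
proof -
  have "indep_var
    borel ((\<lambda>f. f i) \<circ> (\<lambda>\<omega>. restrict (\<lambda>i. X i \<omega>) {i}))
    borel ((\<lambda>f. \<Sum>i\<in>I. f i) \<circ> (\<lambda>\<omega>. restrict (\<lambda>i. X i \<omega>) I))"
    using I by (intro indep_var_compose[OF indep_var_restrict[OF indep]]) auto
  also have "((\<lambda>f. f i) \<circ> (\<lambda>\<omega>. restrict (\<lambda>i. X i \<omega>) {i})) = X i"
    by auto
  also have "((\<lambda>f. \<Sum>i\<in>I. f i) \<circ> (\<lambda>\<omega>. restrict (\<lambda>i. X i \<omega>) I)) = (\<lambda>\<omega>. \<Sum>i\<in>I. X i \<omega>)"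
    by (auto cong: rev_conj_cong)
  finally show ?thesis .
qed

lemma tr_exp_nonneg: "hermitian A \<Longrightarrow> 0 \<le> tr_exp A"
  by (metis exp_ge_zero spectral_theorem sum_nonneg tr_exp_diagonalizes)

lemma hermitian_0: "hermitian 0"
  by (simp add: hermitian_def)

text \<open>
  Conditionally on the other summands, \<open>X j\<close> is averaged with these absorbed into \<open>H\<close>; afterwards its
  mean is absorbed into \<open>H\<close>, which is why \<open>H\<close> is arbitrary in the induction.
\<close>

lemma (in prob_space) nn_integral_tr_exp_sum_le:
  fixes X :: "'i \<Rightarrow> 'a \<Rightarrow> complex^'n^'n"
  assumes "finite I" and "indep_vars (\<lambda>_. borel) X I"
    and "\<And>k. k \<in> I \<Longrightarrow> AE \<omega> in M. spectrum_in 0 L (X k \<omega>)"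
    and chord: "\<And>x. 0 \<le> x \<Longrightarrow> x \<le> L \<Longrightarrow> exp (\<theta> * x) \<le> 1 + c * x"
    and "hermitian H"
  shows "(\<integral>\<^sup>+\<omega>. ennreal (tr_exp (H + \<theta> *\<^sub>R (\<Sum>k\<in>I. X k \<omega>))) \<partial>M)
    \<le> ennreal (tr_exp (H + c *\<^sub>R (\<Sum>k\<in>I. \<integral>\<omega>. X k \<omega> \<partial>M)))"
  using assms(1-3,5)
proof (induction I arbitrary: H)
  case empty
  then show ?case by (simp add: emeasure_space_1)
next
  case (insert j J)
  define S where "S = (\<lambda>\<omega>. \<Sum>k\<in>J. X k \<omega>)"
  define Q where "Q = (\<integral>\<omega>. X j \<omega> \<partial>M)"
  have Xm: "X j \<in> borel_measurable M" using insert.prems(1) by (auto simp: indep_vars_def)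
  have Xj: "AE \<omega> in M. spectrum_in 0 L (X j \<omega>)" using insert.prems(2) by simp
  have Q: "hermitian Q"
    using spectrum_in_expectation[OF integrable_spectrum_in[OF Xm Xj] Xj] by (simp add: Q_def spectrum_in_def)
  have ind: "indep_var borel (X j) borel S"
    unfolding S_def using insert by (intro indep_vars_sum_euclidean)
  have "AE \<omega> in M. \<forall>k\<in>J. spectrum_in 0 L (X k \<omega>)"
    using insert by (intro AE_finite_allI) auto
  then have S: "AE \<omega> in M. hermitian (S \<omega>)"
    unfolding S_def by eventually_elim (auto intro: hermitian_sum simp: spectrum_in_def)
  have "(\<integral>\<^sup>+\<omega>. ennreal (tr_exp (H + \<theta> *\<^sub>R (\<Sum>k\<in>insert j J. X k \<omega>))) \<partial>M)
      = (\<integral>\<^sup>+\<omega>. (\<lambda>(x, y). ennreal (tr_exp (H + \<theta> *\<^sub>R (x + y)))) (X j \<omega>, S \<omega>) \<partial>M)"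
    using insert.hyps by (simp add: S_def)
  also have "\<dots> = (\<integral>\<^sup>+\<omega>'. \<integral>\<^sup>+\<omega>. (\<lambda>(x, y). ennreal (tr_exp (H + \<theta> *\<^sub>R (x + y)))) (X j \<omega>, S \<omega>') \<partial>M \<partial>M)"
    by (rule nn_integral_indep_var[OF ind]) measurable
  also have "\<dots> \<le> (\<integral>\<^sup>+\<omega>'. ennreal (tr_exp ((H + c *\<^sub>R Q) + \<theta> *\<^sub>R S \<omega>')) \<partial>M)"
  proof (rule nn_integral_mono_AE)
    show "AE \<omega>' in M. (\<integral>\<^sup>+\<omega>. (\<lambda>(x, y). ennreal (tr_exp (H + \<theta> *\<^sub>R (x + y)))) (X j \<omega>, S \<omega>') \<partial>M)
        \<le> ennreal (tr_exp ((H + c *\<^sub>R Q) + \<theta> *\<^sub>R S \<omega>'))"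
      using S
    proof eventually_elim
      case (elim \<omega>')
      define H' where "H' = H + \<theta> *\<^sub>R S \<omega>'"
      have H': "hermitian H'"
        unfolding H'_def using elim insert.prems(3) by (intro hermitian_add hermitian_scaleR)
      note step = tr_exp_expectation_le[OF H' Xm Xj chord]
      have "(\<integral>\<^sup>+\<omega>. (\<lambda>(x, y). ennreal (tr_exp (H + \<theta> *\<^sub>R (x + y)))) (X j \<omega>, S \<omega>') \<partial>M)
          = (\<integral>\<^sup>+\<omega>. ennreal (tr_exp (H' + \<theta> *\<^sub>R X j \<omega>)) \<partial>M)"
        by (simp add: H'_def algebra_simps)
      also have "\<dots> = ennreal (\<integral>\<omega>. tr_exp (H' + \<theta> *\<^sub>R X j \<omega>) \<partial>M)"
      proof (rule nn_integral_eq_integral[OF step(1)])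
        show "AE \<omega> in M. 0 \<le> tr_exp (H' + \<theta> *\<^sub>R X j \<omega>)"
          using Xj by eventually_elim
            (intro tr_exp_nonneg hermitian_add hermitian_scaleR H', simp add: spectrum_in_def)
      qed
      also have "\<dots> \<le> ennreal (tr_exp (H' + c *\<^sub>R Q))"
        unfolding Q_def by (rule ennreal_leI[OF step(2)])
      finally show ?case by (simp add: H'_def algebra_simps)
    qed
  qed
  also have "\<dots> \<le> ennreal (tr_exp ((H + c *\<^sub>R Q) + c *\<^sub>R (\<Sum>k\<in>J. \<integral>\<omega>. X k \<omega> \<partial>M)))"
    unfolding S_def
  proof (rule insert.IH)
    show "indep_vars (\<lambda>_. borel) X J" by (rule indep_vars_subset[OF insert.prems(1)]) auto
    show "hermitian (H + c *\<^sub>R Q)"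
      using insert.prems(3) Q by (intro hermitian_add hermitian_scaleR)
  qed (use insert.prems(2) in auto)
  also have "(H + c *\<^sub>R Q) + c *\<^sub>R (\<Sum>k\<in>J. \<integral>\<omega>. X k \<omega> \<partial>M) =
      H + c *\<^sub>R (\<Sum>k\<in>insert j J. \<integral>\<omega>. X k \<omega> \<partial>M)"
    using insert.hyps by (simp add: Q_def algebra_simps)
  finally show ?case .
qed

theorem (in prob_space) tr_exp_sum_le:
  fixes X :: "'i \<Rightarrow> 'a \<Rightarrow> complex^'n^'n"
  assumes I: "finite I" and X: "indep_vars (\<lambda>_. borel) X I"
    and spec: "\<And>k. k \<in> I \<Longrightarrow> AE \<omega> in M. spectrum_in 0 L (X k \<omega>)"
    and chord: "\<And>x. 0 \<le> x \<Longrightarrow> x \<le> L \<Longrightarrow> exp (\<theta> * x) \<le> 1 + c * x"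
  shows "integrable M (\<lambda>\<omega>. tr_exp (\<theta> *\<^sub>R (\<Sum>k\<in>I. X k \<omega>)))"
    and "(\<integral>\<omega>. tr_exp (\<theta> *\<^sub>R (\<Sum>k\<in>I. X k \<omega>)) \<partial>M) \<le> tr_exp (c *\<^sub>R (\<Sum>k\<in>I. \<integral>\<omega>. X k \<omega> \<partial>M))"
proof -
  let ?W = "\<lambda>\<omega>. tr_exp (\<theta> *\<^sub>R (\<Sum>k\<in>I. X k \<omega>))"
  have Xm: "\<And>k. k \<in> I \<Longrightarrow> X k \<in> borel_measurable M" using X by (auto simp: indep_vars_def)
  then have Sm: "(\<lambda>\<omega>. \<Sum>k\<in>I. X k \<omega>) \<in> borel_measurable M" by (intro borel_measurable_sum)
  then have Wm: "?W \<in> borel_measurable M" by measurable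
  have "AE \<omega> in M. \<forall>k\<in>I. spectrum_in 0 L (X k \<omega>)"
    using I spec by (intro AE_finite_allI) auto
  then have Wpos: "AE \<omega> in M. 0 \<le> ?W \<omega>"
    by eventually_elim (auto intro!: tr_exp_nonneg hermitian_scaleR hermitian_sum simp: spectrum_in_def)
  have bound: "(\<integral>\<^sup>+\<omega>. ennreal (?W \<omega>) \<partial>M) \<le> ennreal (tr_exp (c *\<^sub>R (\<Sum>k\<in>I. \<integral>\<omega>. X k \<omega> \<partial>M)))"
    using nn_integral_tr_exp_sum_le[OF I X spec chord hermitian_0] by simp
  show Wi: "integrable M ?W"
  proof (rule integrableI_nonneg[OF Wm Wpos])
    show "(\<integral>\<^sup>+\<omega>. ennreal (?W \<omega>) \<partial>M) < \<infinity>" using bound by (rule le_less_trans) simp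
  qed
  have "hermitian (\<integral>\<omega>. X k \<omega> \<partial>M)" if "k \<in> I" for k
    using spectrum_in_expectation[OF integrable_spectrum_in[OF Xm[OF that] spec[OF that]] spec[OF that]]
    by (simp add: spectrum_in_def)
  then have "0 \<le> tr_exp (c *\<^sub>R (\<Sum>k\<in>I. \<integral>\<omega>. X k \<omega> \<partial>M))"
    by (intro tr_exp_nonneg hermitian_scaleR hermitian_sum)
  then show "(\<integral>\<omega>. ?W \<omega> \<partial>M) \<le> tr_exp (c *\<^sub>R (\<Sum>k\<in>I. \<integral>\<omega>. X k \<omega> \<partial>M))"
    using bound unfolding nn_integral_eq_integral[OF Wi Wpos] by (simp add: ennreal_le_iff)
qed

section \<open>Extreme eigenvalues\<close>

lemma diagonalizes_scaleR:
  assumes "diagonalizes U l A"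
  shows "diagonalizes U (\<lambda>i. c * l i) (c *\<^sub>R A)"
proof -
  have "diag (\<lambda>i. c * l i) = c *\<^sub>R diag l"
    by (simp add: vec_eq_iff diag_def scaleR_conv_of_real[where 'a=complex])
  then have "U ** diag (\<lambda>i. c * l i) ** adj U = c *\<^sub>R (U ** diag l ** adj U)"
    by (simp only: linear_scale[OF linear_matrix_mult])
  then show ?thesis using assms by (simp add: diagonalizes_def)
qed

lemma lambda_max_attained:
  assumes "diagonalizes U l A"
  obtains k where "lambda_max A = l k" and "\<And>i. l i \<le> lambda_max A"
proof -
  have "Max (range l) \<in> range l" by (rule Max_in) auto
  then obtain k where "Max (range l) = l k" by blast
  moreover have "l i \<le> Max (range l)" for i by simp
  ultimately show ?thesis by (intro that[of k]) (simp_all only: lambda_max_diagonalizes[OF assms])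
qed

lemma lambda_min_attained:
  assumes "diagonalizes U l A"
  obtains k where "lambda_min A = l k" and "\<And>i. lambda_min A \<le> l i"
proof -
  have "Min (range l) \<in> range l" by (rule Min_in) auto
  then obtain k where "Min (range l) = l k" by blast
  moreover have "Min (range l) \<le> l i" for i by simp
  ultimately show ?thesis by (intro that[of k]) (simp_all only: lambda_min_diagonalizes[OF assms])
qed

lemma exp_eigenvalue_le_tr_exp:
  assumes "diagonalizes U l A"
  shows "exp (\<theta> * l k) \<le> tr_exp (\<theta> *\<^sub>R A)"
  unfolding tr_exp_diagonalizes[OF diagonalizes_scaleR[OF assms]]
  by (rule member_le_sum) auto

lemma exp_lambda_le_tr_exp:
  assumes "hermitian A"
  shows "exp (\<theta> * lambda_max A) \<le> tr_exp (\<theta> *\<^sub>R A)" "exp (\<theta> * lambda_min A) \<le> tr_exp (\<theta> *\<^sub>R A)"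
proof -
  obtain U l where U: "diagonalizes U l A" using spectral_theorem[OF assms] by blast
  show "exp (\<theta> * lambda_max A) \<le> tr_exp (\<theta> *\<^sub>R A)"
    using lambda_max_attained[OF U] exp_eigenvalue_le_tr_exp[OF U, of \<theta>] by metis
  show "exp (\<theta> * lambda_min A) \<le> tr_exp (\<theta> *\<^sub>R A)"
    using lambda_min_attained[OF U] exp_eigenvalue_le_tr_exp[OF U, of \<theta>] by metis
qed

lemma tr_exp_le:
  fixes A :: "complex^'n^'n"
  assumes "hermitian A"
  shows "0 \<le> c \<Longrightarrow> tr_exp (c *\<^sub>R A) \<le> real CARD('n) * exp (c * lambda_max A)"
    and "c \<le> 0 \<Longrightarrow> tr_exp (c *\<^sub>R A) \<le> real CARD('n) * exp (c * lambda_min A)"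
proof -
  obtain U l where U: "diagonalizes U l A" using spectral_theorem[OF assms] by blast
  have bound: "tr_exp (c *\<^sub>R A) \<le> real CARD('n) * exp (c * m)" if "\<And>i. c * l i \<le> c * m" for m
    unfolding tr_exp_diagonalizes[OF diagonalizes_scaleR[OF U]]
    using sum_bounded_above[of UNIV "\<lambda>i. exp (c * l i)" "exp (c * m)"] that by simp
  show "0 \<le> c \<Longrightarrow> tr_exp (c *\<^sub>R A) \<le> real CARD('n) * exp (c * lambda_max A)"
    by (rule lambda_max_attained[OF U]) (intro bound mult_left_mono)
  show "c \<le> 0 \<Longrightarrow> tr_exp (c *\<^sub>R A) \<le> real CARD('n) * exp (c * lambda_min A)"
    by (rule lambda_min_attained[OF U]) (intro bound mult_left_mono_neg)
qed

lemma abs_lambda_le_norm: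
  assumes "hermitian A"
  shows "\<bar>lambda_max A\<bar> \<le> norm A" "\<bar>lambda_min A\<bar> \<le> norm A"
proof -
  obtain U l where U: "diagonalizes U l A" using spectral_theorem[OF assms] by blast
  show "\<bar>lambda_max A\<bar> \<le> norm A"
    using lambda_max_attained[OF U] abs_eigenvalue_le_norm[OF U] by metis
  show "\<bar>lambda_min A\<bar> \<le> norm A"
    using lambda_min_attained[OF U] abs_eigenvalue_le_norm[OF U] by metis
qed

lemma lambda_min_eq_uminus_lambda_max:
  assumes "hermitian A"
  shows "lambda_min A = - lambda_max (- A)"
proof -
  obtain U l where U: "diagonalizes U l A" using spectral_theorem[OF assms] by blast
  have U': "diagonalizes U (\<lambda>i. - l i) (- A)" using diagonalizes_scaleR[OF U, of "-1"] by simp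
  obtain i where i: "lambda_min A = l i" "\<And>k. lambda_min A \<le> l k"
    using lambda_min_attained[OF U] by blast
  obtain j where j: "lambda_max (- A) = - l j" "\<And>k. - l k \<le> lambda_max (- A)"
    using lambda_max_attained[OF U'] by blast
  show ?thesis using i(1) i(2)[of j] j(1) j(2)[of i] by linarith
qed

text \<open>
  The scaled logarithm of the trace exponential exceeds the largest eigenvalue by at most
  \<open>ln d / n\<close>, which exhibits the latter as a limit of measurable functions.
\<close>

lemma lambda_max_limit:
  fixes A :: "complex^'n^'n"
  assumes "hermitian A"
  shows "(\<lambda>n. ln (tr_exp (real (Suc n) *\<^sub>R A)) / real (Suc n)) \<longlonglongrightarrow> lambda_max A"
proof (rule tendsto_sandwich)
  let ?d = "real CARD('n)"
  show "(\<lambda>n. lambda_max A) \<longlonglongrightarrow> lambda_max A" by simp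
  show "(\<lambda>n. lambda_max A + ln ?d / real (Suc n)) \<longlonglongrightarrow> lambda_max A"
    using tendsto_add[OF tendsto_const[of "lambda_max A"] lim_const_over_n[THEN LIMSEQ_Suc, of "ln ?d"]]
    by simp
  have lower: "real (Suc n) * lambda_max A \<le> ln (tr_exp (real (Suc n) *\<^sub>R A))" for n
    using exp_lambda_le_tr_exp(1)[OF assms, of "real (Suc n)"]
    by (subst ln_ge_iff) (auto intro: less_le_trans[OF exp_gt_zero])
  have upper: "ln (tr_exp (real (Suc n) *\<^sub>R A)) \<le> ln ?d + real (Suc n) * lambda_max A" for n
  proof -
    have "ln (tr_exp (real (Suc n) *\<^sub>R A)) \<le> ln (?d * exp (real (Suc n) * lambda_max A))"
      using exp_lambda_le_tr_exp(1)[OF assms, of "real (Suc n)"] tr_exp_le(1)[OF assms, of "real (Suc n)"]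
      by (intro ln_mono) (auto intro: less_le_trans[OF exp_gt_zero])
    then show ?thesis by (simp add: ln_mult)
  qed
  show "\<forall>\<^sub>F n in sequentially. lambda_max A \<le> ln (tr_exp (real (Suc n) *\<^sub>R A)) / real (Suc n)"
    using lower by (intro always_eventually allI) (simp add: pos_le_divide_eq mult.commute del: of_nat_Suc)
  show "\<forall>\<^sub>F n in sequentially. ln (tr_exp (real (Suc n) *\<^sub>R A)) / real (Suc n) \<le> lambda_max A + ln ?d / real (Suc n)"
    using upper by (intro always_eventually allI) (simp add: field_simps del: of_nat_Suc)
qed

lemma borel_measurable_lambda_max:
  assumes "A \<in> borel_measurable M" "\<And>\<omega>. \<omega> \<in> space M \<Longrightarrow> hermitian (A \<omega>)"
  shows "(\<lambda>\<omega>. lambda_max (A \<omega>)) \<in> borel_measurable M"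
proof (rule borel_measurable_LIMSEQ_real)
  show "(\<lambda>n. ln (tr_exp (real (Suc n) *\<^sub>R A \<omega>)) / real (Suc n)) \<longlonglongrightarrow> lambda_max (A \<omega>)"
    if "\<omega> \<in> space M" for \<omega> by (rule lambda_max_limit[OF assms(2)[OF that]])
  show "(\<lambda>\<omega>. ln (tr_exp (real (Suc n) *\<^sub>R A \<omega>)) / real (Suc n)) \<in> borel_measurable M" for n
    using assms(1) by measurable
qed

lemma borel_measurable_lambda_min:
  assumes "A \<in> borel_measurable M" "\<And>\<omega>. \<omega> \<in> space M \<Longrightarrow> hermitian (A \<omega>)"
  shows "(\<lambda>\<omega>. lambda_min (A \<omega>)) \<in> borel_measurable M"
proof -
  have "(\<lambda>\<omega>. - lambda_max (- A \<omega>)) \<in> borel_measurable M"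
    using assms hermitian_scaleR[of _ "-1"]
    by (intro borel_measurable_uminus borel_measurable_lambda_max) auto
  then show ?thesis
    using assms(2) by (simp add: lambda_min_eq_uminus_lambda_max cong: measurable_cong)
qed

section \<open>The Laplace transform method\<close>

lemma (in prob_space) expectation_le_ln_moment:
  fixes Z W :: "'a \<Rightarrow> real"
  assumes Z: "integrable M Z" and W: "integrable M W"
    and le: "AE \<omega> in M. exp (\<theta> * Z \<omega>) \<le> W \<omega>" and B: "(\<integral>\<omega>. W \<omega> \<partial>M) \<le> B" "0 < B"
  shows "\<theta> * (\<integral>\<omega>. Z \<omega> \<partial>M) \<le> ln B"
proof -
  \<comment> \<open>the tangent to the exponential at \<open>ln B\<close>\<close>
  have "B * (1 + \<theta> * (\<integral>\<omega>. Z \<omega> \<partial>M) - ln B) = (\<integral>\<omega>. B * (1 + \<theta> * Z \<omega> - ln B) \<partial>M)"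
    using Z by (simp add: prob_space)
  also have "\<dots> \<le> (\<integral>\<omega>. W \<omega> \<partial>M)"
  proof (rule integral_mono_AE)
    show "AE \<omega> in M. B * (1 + \<theta> * Z \<omega> - ln B) \<le> W \<omega>"
      using le
    proof eventually_elim
      case (elim \<omega>)
      have "1 + (\<theta> * Z \<omega> - ln B) \<le> exp (\<theta> * Z \<omega> - ln B)" by (rule exp_ge_add_one_self)
      also have "\<dots> = exp (\<theta> * Z \<omega>) / B" using B(2) by (simp add: exp_diff)
      finally have "B * (1 + \<theta> * Z \<omega> - ln B) \<le> exp (\<theta> * Z \<omega>)"
        using B(2) by (simp add: field_simps)
      then show ?case using elim by linarith
    qed
  qed (use Z W in auto)
  also have "\<dots> \<le> B * 1" using B(1) by simp
  finally show ?thesis using B(2) by (simp only: mult_le_cancel_left_pos)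
qed

lemma (in prob_space) prob_le_moment:
  fixes Z W :: "'a \<Rightarrow> real"
  assumes Z: "Z \<in> borel_measurable M" and W: "integrable M W"
    and le: "\<And>\<omega>. \<omega> \<in> space M \<Longrightarrow> exp (\<theta> * Z \<omega>) \<le> W \<omega>" and B: "(\<integral>\<omega>. W \<omega> \<partial>M) \<le> B"
    and S: "S \<in> sets M" "\<And>\<omega>. \<omega> \<in> S \<Longrightarrow> \<theta> * t \<le> \<theta> * Z \<omega>"
  shows "prob S \<le> exp (- (\<theta> * t)) * B"
proof -
  have "prob S = (\<integral>\<omega>. indicator S \<omega> \<partial>M)" using S(1) by simp
  also have "\<dots> \<le> (\<integral>\<omega>. exp (- (\<theta> * t)) * W \<omega> \<partial>M)"
  proof (rule integral_mono)
    fix \<omega> assume \<omega>: "\<omega> \<in> space M"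
    have "indicator S \<omega> \<le> exp (- (\<theta> * t)) * exp (\<theta> * Z \<omega>)"
      using S(2)[of \<omega>] by (auto simp: indicator_def exp_add[symmetric])
    also have "\<dots> \<le> exp (- (\<theta> * t)) * W \<omega>" by (intro mult_left_mono le[OF \<omega>]) simp
    finally show "indicator S \<omega> \<le> exp (- (\<theta> * t)) * W \<omega>" .
  qed (use S(1) W in \<open>auto simp: emeasure_eq_measure\<close>)
  also have "\<dots> \<le> exp (- (\<theta> * t)) * B" using B by simp
  finally show ?thesis .
qed

text \<open>
  Convexity of the exponential, for either sign of \<open>\<theta>\<close>: negative values give the bounds on the
  smallest eigenvalue.
\<close>

lemma exp_chord:
  fixes \<theta> L x :: real
  assumes "0 < L" "0 \<le> x" "x \<le> L"
  shows "exp (\<theta> / L * x) \<le> 1 + (exp \<theta> - 1) / L * x"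
proof -
  have "exp ((1 - x / L) *\<^sub>R 0 + (x / L) *\<^sub>R \<theta>) \<le> (1 - x / L) * exp 0 + x / L * exp \<theta>"
    by (rule convex_onD[OF exp_convex]) (use assms in auto)
  then show ?thesis by (simp add: algebra_simps diff_divide_distrib)
qed

section \<open>The matrix Chernoff inequalities\<close>

text \<open>
  The hypotheses are monotone in \<open>L\<close>, so a bound that is proved for positive \<open>L\<close> can be pushed to
  \<open>L = 0\<close> by letting \<open>L\<close> decrease.
\<close>

locale independent_psd_sum = prob_space M for M :: "'a measure" +
  fixes X :: "'i \<Rightarrow> 'a \<Rightarrow> complex^'n^'n" and I :: "'i set" and L :: real
  assumes finite_I: "finite I"
    and indep: "indep_vars (\<lambda>_. borel) X I"
    and herm: "\<And>k \<omega>. k \<in> I \<Longrightarrow> \<omega> \<in> space M \<Longrightarrow> hermitian (X k \<omega>)"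
    and spec: "\<And>k. k \<in> I \<Longrightarrow> AE \<omega> in M. spectrum_in 0 L (X k \<omega>)"
begin

definition X_sum :: "'a \<Rightarrow> complex^'n^'n" where "X_sum \<omega> = (\<Sum>k\<in>I. X k \<omega>)"

definition mean :: "complex^'n^'n" where "mean = (\<Sum>k\<in>I. \<integral>\<omega>. X k \<omega> \<partial>M)"

lemma X_measurable: "k \<in> I \<Longrightarrow> X k \<in> borel_measurable M"
  using indep by (auto simp: indep_vars_def)

lemma X_integrable: "k \<in> I \<Longrightarrow> integrable M (X k)"
  by (rule integrable_spectrum_in[OF X_measurable spec])

lemma X_sum_integrable: "integrable M X_sum"
  unfolding X_sum_def by (intro Bochner_Integration.integrable_sum X_integrable)

lemma X_sum_hermitian: "\<omega> \<in> space M \<Longrightarrow> hermitian (X_sum \<omega>)"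
  unfolding X_sum_def by (intro hermitian_sum herm)

lemma mean_hermitian: "hermitian mean"
  unfolding mean_def
proof (rule hermitian_sum)
  show "hermitian (\<integral>\<omega>. X k \<omega> \<partial>M)" if "k \<in> I" for k
    using spectrum_in_expectation[OF X_integrable[OF that] spec[OF that]] by (simp add: spectrum_in_def)
qed

lemma lambda_measurable:
  "(\<lambda>\<omega>. lambda_max (X_sum \<omega>)) \<in> borel_measurable M"
  "(\<lambda>\<omega>. lambda_min (X_sum \<omega>)) \<in> borel_measurable M"
  using X_sum_integrable X_sum_hermitian by (auto intro!: borel_measurable_lambda_max borel_measurable_lambda_min)

lemma lambda_integrable:
  "integrable M (\<lambda>\<omega>. lambda_max (X_sum \<omega>))" "integrable M (\<lambda>\<omega>. lambda_min (X_sum \<omega>))"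
  using abs_lambda_le_norm[OF X_sum_hermitian]
  by (auto intro!: Bochner_Integration.integrable_bound[OF integrable_norm[OF X_sum_integrable]]
      lambda_measurable AE_I2)

lemma moment:
  assumes "0 < L"
  shows "integrable M (\<lambda>\<omega>. tr_exp ((\<theta> / L) *\<^sub>R X_sum \<omega>))"
    and "(\<integral>\<omega>. tr_exp ((\<theta> / L) *\<^sub>R X_sum \<omega>) \<partial>M) \<le> tr_exp (((exp \<theta> - 1) / L) *\<^sub>R mean)"
  unfolding X_sum_def mean_def
  using tr_exp_sum_le[OF finite_I indep spec exp_chord[OF assms]] by auto

lemma moment_max:
  assumes "0 < L" "0 \<le> \<theta>"
  shows "(\<integral>\<omega>. tr_exp ((\<theta> / L) *\<^sub>R X_sum \<omega>) \<partial>M)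
    \<le> real CARD('n) * exp ((exp \<theta> - 1) / L * lambda_max mean)"
  using moment(2)[OF assms(1), of \<theta>] tr_exp_le(1)[OF mean_hermitian, of "(exp \<theta> - 1) / L"] assms
  by force

lemma moment_min:
  assumes "0 < L" "\<theta> \<le> 0"
  shows "(\<integral>\<omega>. tr_exp ((\<theta> / L) *\<^sub>R X_sum \<omega>) \<partial>M)
    \<le> real CARD('n) * exp ((exp \<theta> - 1) / L * lambda_min mean)"
proof -
  have "(exp \<theta> - 1) / L \<le> 0" using assms by (intro divide_nonpos_pos) auto
  then show ?thesis
    using moment(2)[OF assms(1), of \<theta>] tr_exp_le(2)[OF mean_hermitian, of "(exp \<theta> - 1) / L"] by linarith
qed

lemma expectation_lambda_max:
  assumes L: "0 < L" and \<theta>: "0 < \<theta>"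
  shows "(\<integral>\<omega>. lambda_max (X_sum \<omega>) \<partial>M)
    \<le> (exp \<theta> - 1) / \<theta> * lambda_max mean + 1 / \<theta> * L * ln (real CARD('n))"
proof -
  have "\<theta> / L * (\<integral>\<omega>. lambda_max (X_sum \<omega>) \<partial>M)
      \<le> ln (real CARD('n) * exp ((exp \<theta> - 1) / L * lambda_max mean))"
  proof (rule expectation_le_ln_moment[OF lambda_integrable(1) moment(1)[OF L] _ moment_max[OF L]])
    show "AE \<omega> in M. exp (\<theta> / L * lambda_max (X_sum \<omega>)) \<le> tr_exp ((\<theta> / L) *\<^sub>R X_sum \<omega>)"
      by (intro AE_I2 exp_lambda_le_tr_exp X_sum_hermitian)
  qed (use \<theta> in auto)
  also have "\<dots> = ln (real CARD('n)) + (exp \<theta> - 1) / L * lambda_max mean" by (simp add: ln_mult)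
  finally show ?thesis using L \<theta> by (simp add: field_simps)
qed

lemma expectation_lambda_min:
  assumes L: "0 < L" and \<theta>: "0 < \<theta>"
  shows "(\<integral>\<omega>. lambda_min (X_sum \<omega>) \<partial>M)
    \<ge> (1 - exp (- \<theta>)) / \<theta> * lambda_min mean - 1 / \<theta> * L * ln (real CARD('n))"
proof -
  have "- \<theta> / L * (\<integral>\<omega>. lambda_min (X_sum \<omega>) \<partial>M)
      \<le> ln (real CARD('n) * exp ((exp (- \<theta>) - 1) / L * lambda_min mean))"
  proof (rule expectation_le_ln_moment[OF lambda_integrable(2) moment(1)[OF L] _ moment_min[OF L]])
    show "AE \<omega> in M. exp (- \<theta> / L * lambda_min (X_sum \<omega>)) \<le> tr_exp ((- \<theta> / L) *\<^sub>R X_sum \<omega>)"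
      by (intro AE_I2 exp_lambda_le_tr_exp X_sum_hermitian)
  qed (use \<theta> in auto)
  also have "\<dots> = ln (real CARD('n)) + (exp (- \<theta>) - 1) / L * lambda_min mean" by (simp add: ln_mult)
  finally have "- (L / \<theta>) * (ln (real CARD('n)) + (exp (- \<theta>) - 1) / L * lambda_min mean)
      \<le> - (L / \<theta>) * (- \<theta> / L * (\<integral>\<omega>. lambda_min (X_sum \<omega>) \<partial>M))"
    using L \<theta> by (intro mult_left_mono_neg) auto
  also have "\<dots> = (\<integral>\<omega>. lambda_min (X_sum \<omega>) \<partial>M)" using L \<theta> by simp
  also have "- (L / \<theta>) * (ln (real CARD('n)) + (exp (- \<theta>) - 1) / L * lambda_min mean)
      = (1 - exp (- \<theta>)) / \<theta> * lambda_min mean - 1 / \<theta> * L * ln (real CARD('n))"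
    using L \<theta> by (simp add: field_simps)
  finally show ?thesis .
qed

end

text \<open>
  The Markov bound at \<open>\<theta> = ln (1 + \<epsilon>)\<close>, which minimises it. The lower tail is the case of negative \<open>\<epsilon>\<close>.
\<close>

lemma chernoff_exponent:
  fixes \<epsilon> \<mu> L :: real
  assumes "- 1 < \<epsilon>"
  shows "exp (- (ln (1 + \<epsilon>) / L * ((1 + \<epsilon>) * \<mu>))) * (d * exp ((exp (ln (1 + \<epsilon>)) - 1) / L * \<mu>))
    = d * (exp \<epsilon> / (1 + \<epsilon>) powr (1 + \<epsilon>)) powr (\<mu> / L)"
proof -
  have "exp \<epsilon> / (1 + \<epsilon>) powr (1 + \<epsilon>) = exp (\<epsilon> - (1 + \<epsilon>) * ln (1 + \<epsilon>))"
    using assms by (simp add: powr_def exp_diff)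
  then have "(exp \<epsilon> / (1 + \<epsilon>) powr (1 + \<epsilon>)) powr (\<mu> / L) = exp (\<mu> / L * (\<epsilon> - (1 + \<epsilon>) * ln (1 + \<epsilon>)))"
    by (simp add: powr_def)
  also have "\<mu> / L * (\<epsilon> - (1 + \<epsilon>) * ln (1 + \<epsilon>)) = - (ln (1 + \<epsilon>) / L * ((1 + \<epsilon>) * \<mu>)) + \<epsilon> / L * \<mu>"
    by (simp add: algebra_simps diff_divide_distrib add_divide_distrib)
  finally have "d * (exp \<epsilon> / (1 + \<epsilon>) powr (1 + \<epsilon>)) powr (\<mu> / L) =
      exp (- (ln (1 + \<epsilon>) / L * ((1 + \<epsilon>) * \<mu>))) * (d * exp (\<epsilon> / L * \<mu>))"
    by (simp only: exp_add) (simp only: mult_ac)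
  moreover have "exp (ln (1 + \<epsilon>)) - 1 = \<epsilon>" using assms by simp
  ultimately show ?thesis by (simp only:)
qed

context independent_psd_sum
begin

lemma tail_lambda_max:
  assumes L: "0 < L" and \<epsilon>: "0 \<le> \<epsilon>"
  shows "\<P>(\<omega> in M. lambda_max (X_sum \<omega>) \<ge> (1 + \<epsilon>) * lambda_max mean)
    \<le> real CARD('n) * (exp \<epsilon> / (1 + \<epsilon>) powr (1 + \<epsilon>)) powr (lambda_max mean / L)"
proof -
  define \<theta> where "\<theta> = ln (1 + \<epsilon>)"
  have \<theta>: "0 \<le> \<theta>" using \<epsilon> by (simp add: \<theta>_def)
  have "\<P>(\<omega> in M. lambda_max (X_sum \<omega>) \<ge> (1 + \<epsilon>) * lambda_max mean)
      \<le> exp (- (\<theta> / L * ((1 + \<epsilon>) * lambda_max mean)))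
        * (real CARD('n) * exp ((exp \<theta> - 1) / L * lambda_max mean))"
  proof (rule prob_le_moment[OF lambda_measurable(1) moment(1)[OF L] _ moment_max[OF L \<theta>]])
    show "{\<omega> \<in> space M. (1 + \<epsilon>) * lambda_max mean \<le> lambda_max (X_sum \<omega>)} \<in> sets M"
      using lambda_measurable(1) by measurable
    show "\<theta> / L * ((1 + \<epsilon>) * lambda_max mean) \<le> \<theta> / L * lambda_max (X_sum \<omega>)"
      if "\<omega> \<in> {\<omega> \<in> space M. (1 + \<epsilon>) * lambda_max mean \<le> lambda_max (X_sum \<omega>)}" for \<omega>
      using that L \<theta> by (intro mult_left_mono) auto
  qed (intro exp_lambda_le_tr_exp X_sum_hermitian)
  also have "\<dots> = real CARD('n) * (exp \<epsilon> / (1 + \<epsilon>) powr (1 + \<epsilon>)) powr (lambda_max mean / L)"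
    unfolding \<theta>_def by (rule chernoff_exponent) (use \<epsilon> in simp)
  finally show ?thesis .
qed

lemma tail_lambda_min:
  assumes L: "0 < L" and \<epsilon>: "0 \<le> \<epsilon>" "\<epsilon> < 1"
  shows "\<P>(\<omega> in M. lambda_min (X_sum \<omega>) \<le> (1 - \<epsilon>) * lambda_min mean)
    \<le> real CARD('n) * (exp (- \<epsilon>) / (1 - \<epsilon>) powr (1 - \<epsilon>)) powr (lambda_min mean / L)"
proof -
  define \<theta> where "\<theta> = ln (1 + - \<epsilon>)"
  have \<theta>: "\<theta> \<le> 0" using \<epsilon> by (simp add: \<theta>_def)
  have "\<theta> / L \<le> 0" using \<theta> L by (simp add: divide_le_0_iff)
  have "\<P>(\<omega> in M. lambda_min (X_sum \<omega>) \<le> (1 - \<epsilon>) * lambda_min mean)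
      \<le> exp (- (\<theta> / L * ((1 + - \<epsilon>) * lambda_min mean)))
        * (real CARD('n) * exp ((exp \<theta> - 1) / L * lambda_min mean))"
  proof (rule prob_le_moment[OF lambda_measurable(2) moment(1)[OF L] _ moment_min[OF L \<theta>]])
    show "{\<omega> \<in> space M. lambda_min (X_sum \<omega>) \<le> (1 - \<epsilon>) * lambda_min mean} \<in> sets M"
      using lambda_measurable(2) by measurable
    show "\<theta> / L * ((1 + - \<epsilon>) * lambda_min mean) \<le> \<theta> / L * lambda_min (X_sum \<omega>)"
      if "\<omega> \<in> {\<omega> \<in> space M. lambda_min (X_sum \<omega>) \<le> (1 - \<epsilon>) * lambda_min mean}" for \<omega>
      using that \<open>\<theta> / L \<le> 0\<close> by (intro mult_left_mono_neg) auto
  qed (intro exp_lambda_le_tr_exp X_sum_hermitian)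
  also have "\<dots> = real CARD('n) * (exp (- \<epsilon>) / (1 + - \<epsilon>) powr (1 + - \<epsilon>)) powr (lambda_min mean / L)"
    unfolding \<theta>_def by (rule chernoff_exponent) (use \<epsilon> in simp)
  finally show ?thesis by simp
qed

end

lemma mat_expectation_eq_integral:
  fixes A :: "'a \<Rightarrow> complex^'n^'n"
  assumes "integrable M A"
  shows "mat_expectation M A = (\<integral>\<omega>. A \<omega> \<partial>M)"
proof -
  have "(\<integral>\<omega>. A \<omega> \<partial>M) $ i $ j = (\<integral>\<omega>. A \<omega> $ i $ j \<partial>M)" for i j
  proof -
    have "bounded_linear (\<lambda>B :: complex^'n^'n. B $ i $ j)"
      by (rule bounded_linear_compose[OF bounded_linear_vec_nth bounded_linear_vec_nth])
    then show ?thesis using integral_bounded_linear assms by fastforce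
  qed
  then show ?thesis by (simp add: mat_expectation_def vec_eq_iff)
qed

theorem theorem5p1p1:
  fixes M :: "'a measure"
    and I :: "'i set"
    and X :: "'i \<Rightarrow> 'a \<Rightarrow> complex^'n^'n"
    and Y :: "'a \<Rightarrow> complex^'n^'n"
    and L \<mu>_min \<mu>_max d :: real
  assumes "prob_space M"
    and "finite I"
    and "prob_space.indep_vars M (\<lambda>_. borel) X I"
    and "\<And>k \<omega>. k \<in> I \<Longrightarrow> \<omega> \<in> space M \<Longrightarrow> hermitian (X k \<omega>)"
    and "\<And>k. k \<in> I \<Longrightarrow> AE \<omega> in M. 0 \<le> lambda_min (X k \<omega>)"
    and "\<And>k. k \<in> I \<Longrightarrow> AE \<omega> in M. lambda_max (X k \<omega>) \<le> L"
    and "0 \<le> L"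
    and "d = real CARD('n)"
    and "Y = (\<lambda>\<omega>. \<Sum>k\<in>I. X k \<omega>)"
    and "\<mu>_min = lambda_min (mat_expectation M Y)"
    and "\<mu>_max = lambda_max (mat_expectation M Y)"
  shows "\<mu>_min = lambda_min (\<Sum>k\<in>I. mat_expectation M (X k)) \<and>
    \<mu>_max = lambda_max (\<Sum>k\<in>I. mat_expectation M (X k)) \<and>
    (\<forall>\<theta>::real. \<theta> > 0 \<longrightarrow>
      (\<integral>\<omega>. lambda_min (Y \<omega>) \<partial>M) \<ge> (1 - exp (- \<theta>)) / \<theta> * \<mu>_min - 1 / \<theta> * L * ln d \<and>
      (\<integral>\<omega>. lambda_max (Y \<omega>) \<partial>M) \<le> (exp \<theta> - 1) / \<theta> * \<mu>_max + 1 / \<theta> * L * ln d) \<and>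
    (\<forall>\<epsilon>::real. 0 \<le> \<epsilon> \<and> \<epsilon> < 1 \<longrightarrow>
      \<P>(\<omega> in M. lambda_min (Y \<omega>) \<le> (1 - \<epsilon>) * \<mu>_min)
        \<le> d * (exp (- \<epsilon>) / (1 - \<epsilon>) powr (1 - \<epsilon>)) powr (\<mu>_min / L)) \<and>
    (\<forall>\<epsilon>::real. 0 \<le> \<epsilon> \<longrightarrow>
      \<P>(\<omega> in M. lambda_max (Y \<omega>) \<ge> (1 + \<epsilon>) * \<mu>_max)
        \<le> d * (exp \<epsilon> / (1 + \<epsilon>) powr (1 + \<epsilon>)) powr (\<mu>_max / L))"
proof -
  interpret prob_space M by (rule assms(1))
  have loc: "independent_psd_sum M X I L'" if "L \<le> L'" for L'
  proof unfold_locales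
    fix k assume k: "k \<in> I"
    show "AE \<omega> in M. spectrum_in 0 L' (X k \<omega>)"
      using AE_space assms(5)[OF k] assms(6)[OF k]
    proof eventually_elim
      case (elim \<omega>)
      then show ?case using assms(4)[OF k] that by (simp add: spectrum_in_def)
    qed
  qed (use assms(2-4) in auto)
  interpret independent_psd_sum M X I L by (rule loc) simp
  have Y: "Y = X_sum" by (simp add: assms(9) X_sum_def fun_eq_iff)
  have mean: "mean = (\<Sum>k\<in>I. mat_expectation M (X k))"
    by (simp add: mean_def mat_expectation_eq_integral X_integrable)
  have "mat_expectation M Y = mean"
    unfolding Y mat_expectation_eq_integral[OF X_sum_integrable]
    by (simp add: X_sum_def[abs_def] mean_def X_integrable)
  then have \<mu>: "\<mu>_min = lambda_min mean" "\<mu>_max = lambda_max mean" by (simp_all add: assms(10,11))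
  have d: "1 \<le> d" by (simp add: assms(8) Suc_leI)
  have expectation_bounds:
    "(\<integral>\<omega>. lambda_min (Y \<omega>) \<partial>M) \<ge> (1 - exp (- \<theta>)) / \<theta> * \<mu>_min - 1 / \<theta> * L * ln d"
    "(\<integral>\<omega>. lambda_max (Y \<omega>) \<partial>M) \<le> (exp \<theta> - 1) / \<theta> * \<mu>_max + 1 / \<theta> * L * ln d"
    if \<theta>: "\<theta> > 0" for \<theta>
  proof -
    \<comment> \<open>Any larger bound may replace \<open>L\<close>; letting it decrease to \<open>L\<close> also settles \<open>L = 0\<close>.\<close>
    have approx: "1 / \<theta> * L' * ln d \<le> 1 / \<theta> * L * ln d + e"
      if e: "0 < e" and L': "L' = L + \<theta> * e / (1 + ln d)" for e L'
    proof -
      have "1 / \<theta> * L' * ln d = 1 / \<theta> * L * ln d + e * (ln d / (1 + ln d))"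
        unfolding L' using \<theta> by (simp add: field_simps)
      moreover have "e * (ln d / (1 + ln d)) \<le> e * 1"
        using e d by (intro mult_left_mono) (auto simp: divide_le_eq_1 add_pos_nonneg)
      ultimately show ?thesis by simp
    qed
    have L': "L \<le> L + \<theta> * e / (1 + ln d)" "0 < L + \<theta> * e / (1 + ln d)" if "0 < e" for e
    proof -
      have "0 < \<theta> * e / (1 + ln d)"
        using that \<theta> d by (intro divide_pos_pos mult_pos_pos add_pos_nonneg) auto
      then show "L \<le> L + \<theta> * e / (1 + ln d)" "0 < L + \<theta> * e / (1 + ln d)" using assms(7) by auto
    qed
    show "(\<integral>\<omega>. lambda_min (Y \<omega>) \<partial>M) \<ge> (1 - exp (- \<theta>)) / \<theta> * \<mu>_min - 1 / \<theta> * L * ln d"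
    proof (rule field_le_epsilon)
      fix e :: real assume e: "0 < e"
      show "(1 - exp (- \<theta>)) / \<theta> * \<mu>_min - 1 / \<theta> * L * ln d \<le> (\<integral>\<omega>. lambda_min (Y \<omega>) \<partial>M) + e"
        using independent_psd_sum.expectation_lambda_min[OF loc[OF L'(1)[OF e]] L'(2)[OF e] \<theta>]
          approx[OF e refl]
        unfolding Y \<mu> assms(8)[symmetric] by linarith
    qed
    show "(\<integral>\<omega>. lambda_max (Y \<omega>) \<partial>M) \<le> (exp \<theta> - 1) / \<theta> * \<mu>_max + 1 / \<theta> * L * ln d"
    proof (rule field_le_epsilon)
      fix e :: real assume e: "0 < e"
      show "(\<integral>\<omega>. lambda_max (Y \<omega>) \<partial>M) \<le> (exp \<theta> - 1) / \<theta> * \<mu>_max + 1 / \<theta> * L * ln d + e"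
        using independent_psd_sum.expectation_lambda_max[OF loc[OF L'(1)[OF e]] L'(2)[OF e] \<theta>]
          approx[OF e refl]
        unfolding Y \<mu> assms(8)[symmetric] by linarith
    qed
  qed
  \<comment> \<open>For \<open>L = 0\<close> the exponent is \<open>x / 0 = 0\<close> and the right-hand sides equal \<open>d\<close>.\<close>
  have trivial: "p \<le> d * b powr (x / L)" if "L = 0" "p \<le> 1" "b > 0" for p b x :: real
    using that d by simp
  have tail_min: "\<P>(\<omega> in M. lambda_min (Y \<omega>) \<le> (1 - \<epsilon>) * \<mu>_min)
      \<le> d * (exp (- \<epsilon>) / (1 - \<epsilon>) powr (1 - \<epsilon>)) powr (\<mu>_min / L)" if "0 \<le> \<epsilon>" "\<epsilon> < 1" for \<epsilon>
  proof (cases "L = 0")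
    case True
    then show ?thesis using that by (intro trivial) auto
  next
    case False
    then show ?thesis
      using tail_lambda_min[of \<epsilon>] assms(7) that unfolding Y \<mu> assms(8) by simp
  qed
  have tail_max: "\<P>(\<omega> in M. lambda_max (Y \<omega>) \<ge> (1 + \<epsilon>) * \<mu>_max)
      \<le> d * (exp \<epsilon> / (1 + \<epsilon>) powr (1 + \<epsilon>)) powr (\<mu>_max / L)" if "0 \<le> \<epsilon>" for \<epsilon>
  proof (cases "L = 0")
    case True
    then show ?thesis using that by (intro trivial) auto
  next
    case False
    then show ?thesis
      using tail_lambda_max[of \<epsilon>] assms(7) that unfolding Y \<mu> assms(8) by simp
  qed
  show ?thesis
    using \<mu> mean expectation_bounds tail_min tail_max by auto
qed

end
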